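(* Let $N=\mathbb Z^3/\mathbb Z\cdot(1,1,1)$ and $M=\{r\in\mathbb Z^3\mid r_0+r_1+r_2=0\}$, and view $\mathbb P^2$ as the toric variety whose rays $\rho_0,\rho_1,\rho_2\in N$ are the classes of the standard basis vectors of $\mathbb Z^3$. The Higgs range $\mathcal H(\mathbb P^2)$ of the tangent sheaf $\mathcal T_{\mathbb P^2}$ equals the convex hull of the points $r^0=[-2,1,1]$, $r^1=[1,-2,1]$ and $r^2=[1,1,-2]$. Moreover, for each $\nu\in\mathbb Z/3\mathbb Z$ we have $\phi^{r^\nu}_{s^\nu}=0$ for (the linear map $\phi^{r^\nu}$ associated to) every homogeneous pre-Higgs field of degree $r^\nu$, where $s^0=[0,1,-1]$, $s^1=[-1,0,1]$, $s^2=[1,-1,0]$. The dimension of the vector space $V^0_r(\mathbb P^2)$ equals $1$ if $r$ is a vertex of $\mathcal H(\mathbb P^2)$, equals $2$ if $r$ is among the six remaining lattice points on the boundary of $\mathcal H(\mathbb P^2)$, and equals $3$ for $r=0$.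
   Context: $T=N\otimes_{\mathbb Z}\mathbb C^*$ is the torus of $X=\mathbb P^2$, $N_{\mathbb C}=N\otimes\mathbb C$, $M$ is dual to $N$ via the standard pairing on $\mathbb Z^3$, $M_{\mathbb R}=M\otimes\mathbb R$, and $\chi^r$ is the character of $r\in M$. A pre-Higgs field on the tangent sheaf $\mathcal T_X$ is an $\mathcal O_X$-linear map $\Phi:\mathcal T_X\to\mathcal T_X\otimes_{\mathcal O_X}\mathcal T_X$ (no integrability condition; "Higgs" here means what is usually called "co-Higgs"). Identifying the fibre of $\mathcal T_X$ at $1\in T$ with $N_{\mathbb C}$, each such $\Phi$ is a finite sum $\Phi=\sum_{r\in M}\Phi^r$ of homogeneous pre-Higgs fields $\Phi^r=\phi^r\otimes\chi^r$ of degree $r$ (that is, $\Phi^r$ is $T$-equivariant as a map into $\mathcal T_X\otimes\mathcal T_X$ with $T$-action twisted by $\chi^r$), where $\phi^r:N_{\mathbb C}\to N_{\mathbb C}\otimes N_{\mathbb C}$ is the associated $\mathbb C$-linear map. For $s\in M$, regarded as a linear map $N_{\mathbb C}\to\mathbb C$, put $\phi^r_s=(\mathrm{id}\otimes s)\circ\phi^r\in\mathrm{End}(N_{\mathbb C})$, contracting the second tensor factor (the one belonging to the right-hand $\mathcal T_X$ in $\mathcal T_X\otimes\mathcal T_X$). A degree $r\in M$ is admissible if there is a nonzero homogeneous pre-Higgs field of degree $r$. The Higgs range $\mathcal H(X)=\mathcal H(\mathcal T_X)$ is the convex hull in $M_{\mathbb R}$ of the admissible degrees. $V_r(X)$ is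 the complex vector space of maps $\phi:N_{\mathbb C}\to N_{\mathbb C}\otimes N_{\mathbb C}$ associated to homogeneous pre-Higgs fields of degree $r$, and $V^0_r(X)\subseteq V_r(X)$ is the subspace of trace-free ones, i.e. those with $\mathrm{tr}(\phi_s)=0$ for all $s\in M$. *)

theory Defs
  imports
    "HOL-Analysis.Analysis"
    "HOL-Library.Poly_Mapping"
    "HOL-Library.Function_Algebras"
begin

section \<open>The lattices \<open>M\<close> and \<open>N\<close>\<close>

text \<open>Coordinates are indexed by the type \<^typ>\<open>3\<close> of integers modulo 3, so the indices are
  \<^term>\<open>0::3\<close>, \<^term>\<open>1::3\<close>, \<^term>\<open>2::3\<close>.\<close>

typedef M = "{m :: int ^ 3. (\<Sum>i\<in>UNIV. m $ i) = 0}"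
  morphisms vec_of_M M_of_vec
  by (rule exI[of _ 0]) simp

setup_lifting type_definition_M

instantiation M :: ab_group_add
begin
lift_definition zero_M :: M is 0 by simp
lift_definition plus_M :: "M \<Rightarrow> M \<Rightarrow> M" is "(+)" by (simp add: sum.distrib)
lift_definition minus_M :: "M \<Rightarrow> M \<Rightarrow> M" is "(-)" by (simp add: sum_subtractf)
lift_definition uminus_M :: "M \<Rightarrow> M" is uminus by (simp add: sum_negf)
instance by standard (transfer; simp)+
end

text \<open>\<open>mpt a b c\<close> is the element \<open>[a, b, c]\<close> of \<open>M\<close>; it is only meaningful if \<open>a + b + c = 0\<close>.
  (The library's \<^const>\<open>vector\<close> would put the last entry at index \<open>3 = 0\<close>.)\<close>

definition mpt :: "int \<Rightarrow> int \<Rightarrow> int \<Rightarrow> M" where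
  "mpt a b c = M_of_vec (\<chi> i. if i = 0 then a else if i = 1 then b else c)"

text \<open>\<open>M\<^sub>\<real>\<close> is the plane of vectors with coordinate sum 0 in \<open>\<real>\<^sup>3\<close>; this is its lattice embedding.\<close>

definition real_M :: "M \<Rightarrow> real ^ 3" where
  "real_M m = (\<chi> i. of_int (vec_of_M m $ i))"

text \<open>\<open>int lat\<close> is \<open>N = \<int>\<^sup>3 / \<int>(1,1,1)\<close>, and \<open>complex lat\<close> is
  \<open>N\<^sub>\<complex> = \<complex>\<^sup>3 / \<complex>(1,1,1)\<close>.\<close>

quotient_type (overloaded) 'a lat =
  "'a::comm_ring_1 ^ 3" / "\<lambda>u v. \<exists>c. \<forall>i. u $ i - v $ i = c"
proof (rule equivpI)
  show "reflp (\<lambda>u v :: 'a ^ 3. \<exists>c. \<forall>i. u $ i - v $ i = c)"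
    by (rule reflpI) auto
  show "symp (\<lambda>u v :: 'a ^ 3. \<exists>c. \<forall>i. u $ i - v $ i = c)"
    by (rule sympI) (metis minus_diff_eq)
  show "transp (\<lambda>u v :: 'a ^ 3. \<exists>c. \<forall>i. u $ i - v $ i = c)"
  proof (rule transpI)
    fix x y z :: "'a ^ 3"
    assume "\<exists>c. \<forall>i. x $ i - y $ i = c" "\<exists>c. \<forall>i. y $ i - z $ i = c"
    then obtain c d where cd: "\<forall>i. x $ i - y $ i = c" "\<forall>i. y $ i - z $ i = d" by blast
    have "x $ i - z $ i = c + d" for i
      using cd[rule_format, of i] by (simp add: algebra_simps)
    then show "\<exists>c. \<forall>i. x $ i - z $ i = c" by blast
  qed
qed

instantiation lat :: (comm_ring_1) ab_group_add
begin
lift_definition zero_lat :: "'a lat" is 0 .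
lift_definition plus_lat :: "'a lat \<Rightarrow> 'a lat \<Rightarrow> 'a lat" is "(+)"
  by (metis add_diff_add vector_add_component)
lift_definition minus_lat :: "'a lat \<Rightarrow> 'a lat \<Rightarrow> 'a lat" is "(-)"
proof -
  fix u v x y :: "'a ^ 3"
  assume "\<exists>c. \<forall>i. u $ i - v $ i = c" "\<exists>c. \<forall>i. x $ i - y $ i = c"
  then obtain c d where cd: "\<forall>i. u $ i - v $ i = c" "\<forall>i. x $ i - y $ i = d" by blast
  have "(u - x) $ i - (v - y) $ i = c - d" for i
    using cd[rule_format, of i] by (simp add: algebra_simps)
  then show "\<exists>c. \<forall>i. (u - x) $ i - (v - y) $ i = c" by blast
qed
lift_definition uminus_lat :: "'a lat \<Rightarrow> 'a lat" is uminus
proof -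
  fix u v :: "'a ^ 3"
  assume "\<exists>c. \<forall>i. u $ i - v $ i = c"
  then obtain c where c: "\<forall>i. u $ i - v $ i = c" by blast
  have "(- u) $ i - (- v) $ i = - c" for i
    using c[rule_format, of i] by (simp add: algebra_simps)
  then show "\<exists>c. \<forall>i. (- u) $ i - (- v) $ i = c" by blast
qed
instance
  by standard (transfer; rule exI[of _ 0]; simp add: algebra_simps)+
end

lift_definition scale_lat :: "'a::comm_ring_1 \<Rightarrow> 'a lat \<Rightarrow> 'a lat" is "\<lambda>a u. \<chi> i. a * u $ i"
  by (metis right_diff_distrib vec_lambda_beta)

lift_definition ray :: "3 \<Rightarrow> 'a::comm_ring_1 lat" is "\<lambda>i. axis i 1" .

lift_definition pair :: "M \<Rightarrow> 'a::comm_ring_1 lat \<Rightarrow> 'a"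
  is "\<lambda>m u. \<Sum>i\<in>UNIV. of_int (m $ i) * u $ i"
proof goal_cases
  case (1 m u v)
  then obtain c where c: "u $ i - v $ i = c" for i by blast
  have "(\<Sum>i\<in>UNIV. of_int (m $ i) * u $ i) - (\<Sum>i\<in>UNIV. of_int (m $ i) * v $ i)
      = (\<Sum>i\<in>UNIV. of_int (m $ i) * c)"
    by (simp flip: sum_subtractf right_diff_distrib add: c)
  also have "\<dots> = of_int (\<Sum>i\<in>UNIV. m $ i) * c"
    by (simp only: of_int_sum sum_distrib_right)
  also have "\<dots> = 0" using 1 by simp
  finally show ?case by simp
qed

global_interpretation NC: vector_space "scale_lat :: complex \<Rightarrow> complex lat \<Rightarrow> complex lat"
  by standard (transfer; rule exI[of _ 0]; simp add: algebra_simps)+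

lemma pair_ray: "pair m (ray i) = of_int (vec_of_M m $ i)"
  by transfer (simp add: axis_def if_distrib[of "\<lambda>x. _ * x"] cong: if_cong)

lemma pair_add: "pair m (n + n') = pair m n + pair m n'"
  by transfer (simp add: algebra_simps sum.distrib)

lemma pair_scale: "pair m (scale_lat c n) = c * pair m n"
  by transfer (simp add: sum_distrib_left algebra_simps)

lemma pair_zero: "pair m 0 = 0"
  by transfer simp

lemma UNIV_3': "(UNIV :: 3 set) = {0, 1, 2}"
  using UNIV_3 by auto

lemma sum_3': "(\<Sum>i\<in>(UNIV :: 3 set). f i) = f 0 + f 1 + f 2" for f :: "3 \<Rightarrow> 'a::comm_monoid_add"
  unfolding UNIV_3' by (simp add: add.assoc)

lemma forall_3': "(\<forall>i::3. P i) \<longleftrightarrow> P 0 \<and> P 1 \<and> P 2"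
  using UNIV_3' by (metis UNIV_I insertE singletonD)

lemma vec_of_mpt:
  assumes "a + b + c = 0"
  shows "vec_of_M (mpt a b c) = (\<chi> i. if i = 0 then a else if i = 1 then b else c)"
  unfolding mpt_def using assms by (intro M_of_vec_inverse) (simp only: mem_Collect_eq sum_3', simp)

section \<open>Projective plane and tangent sheaf on the toric charts\<close>

text \<open>A face of the fan is identified with the set of its rays; the fan of the projective plane
  consists of the cones spanned by the proper subsets of the three rays. The chart of the cone \<open>I\<close>
  is the spectrum of the semigroup algebra \<open>chart I\<close>, a subalgebra of the group algebra
  \<open>\<complex>[M]\<close>; for \<open>J \<subseteq> I\<close> the chart of \<open>J\<close> is open in that of \<open>I\<close>, and the charts are glued
  along these inclusions.\<close>

type_synonym CM = "M \<Rightarrow>\<^sub>0 complex"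

definition fan :: "3 set set" where
  "fan = {I. I \<noteq> UNIV}"

definition chart :: "3 set \<Rightarrow> CM set" where
  "chart I = {f. \<forall>m\<in>Poly_Mapping.keys f. \<forall>i\<in>I. pair m (ray i :: int lat) \<ge> 0}"

abbreviation chi :: "M \<Rightarrow> CM" where
  "chi m \<equiv> Poly_Mapping.single m 1"

abbreviation const :: "complex \<Rightarrow> CM" where
  "const c \<equiv> Poly_Mapping.single 0 c"

text \<open>The module \<open>Der\<^sub>\<complex>(chart I)\<close> of sections of the tangent sheaf. Maps on \<open>chart I\<close> are
  represented by their extension by zero to \<open>\<complex>[M]\<close>.\<close>

definition Der :: "3 set \<Rightarrow> (CM \<Rightarrow> CM) set" where
  "Der I = {D. (\<forall>f. f \<notin> chart I \<longrightarrow> D f = 0) \<and>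
     (\<forall>f\<in>chart I. D f \<in> chart I) \<and>
     (\<forall>f\<in>chart I. \<forall>g\<in>chart I. D (f + g) = D f + D g) \<and>
     (\<forall>c. \<forall>f\<in>chart I. D (const c * f) = const c * D f) \<and>
     (\<forall>f\<in>chart I. \<forall>g\<in>chart I. D (f * g) = D f * g + f * D g)}"

text \<open>The module \<open>Der(A) \<otimes>\<^sub>A Der(A)\<close> for \<open>A = chart I\<close>, \<open>I \<in> fan\<close>. As \<open>A\<close> is smooth (a localisation
  of a polynomial ring), \<open>Der(A)\<close> is free of finite rank and the natural map sending \<open>D \<otimes> E\<close> to
  the biderivation \<open>(f, g) \<mapsto> D f * E g\<close> is injective; the tensor product is represented by its
  image, the set of finite sums of such biderivations.\<close>

definition Der2 :: "3 set \<Rightarrow> (CM \<Rightarrow> CM \<Rightarrow> CM) set" where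
  "Der2 I = {\<Psi>. \<exists>(k::nat) D E. (\<forall>j<k. D j \<in> Der I \<and> E j \<in> Der I) \<and>
     \<Psi> = (\<lambda>f g. \<Sum>j<k. D j f * E j g)}"

section \<open>Pre-Higgs fields\<close>

text \<open>A morphism from the tangent sheaf to its tensor square: a linear map of modules on every
  chart, compatible with restriction. For \<open>J \<subseteq> I\<close>, the restriction to the chart of \<open>J\<close> of a section
  \<open>D\<close> over the chart of \<open>I\<close> is the unique \<open>E \<in> Der J\<close> that agrees with \<open>D\<close> on \<open>chart I\<close>, and
  similarly for the tensor square.\<close>

type_synonym field = "3 set \<Rightarrow> (CM \<Rightarrow> CM) \<Rightarrow> (CM \<Rightarrow> CM \<Rightarrow> CM)"

definition pre_higgs :: "field \<Rightarrow> bool" where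
  "pre_higgs \<Phi> \<longleftrightarrow>
     (\<forall>I\<in>fan. \<forall>D\<in>Der I. \<Phi> I D \<in> Der2 I) \<and>
     (\<forall>I\<in>fan. \<forall>D\<in>Der I. \<forall>E\<in>Der I.
        \<Phi> I (\<lambda>f. D f + E f) = (\<lambda>f g. \<Phi> I D f g + \<Phi> I E f g)) \<and>
     (\<forall>I\<in>fan. \<forall>a\<in>chart I. \<forall>D\<in>Der I.
        \<Phi> I (\<lambda>f. a * D f) = (\<lambda>f g. a * \<Phi> I D f g)) \<and>
     (\<forall>I\<in>fan. \<forall>J\<subseteq>I. \<forall>D\<in>Der I. \<forall>E\<in>Der J. (\<forall>f\<in>chart I. E f = D f) \<longrightarrow>
        (\<forall>f\<in>chart I. \<forall>g\<in>chart I. \<Phi> J E f g = \<Phi> I D f g))"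

text \<open>Points of \<open>T = N \<otimes> \<complex>\<^sup>*\<close>, the quotient of \<open>(\<complex>\<^sup>*)\<^sup>3\<close> by its diagonal, are given by
  representatives in \<open>(\<complex>\<^sup>*)\<^sup>3\<close>. The action on functions is \<open>(t \<bullet> f)(x) = f (t x)\<close>, and it is
  carried over to (bi)derivations by conjugation. With this convention
  \<open>\<phi> \<otimes> \<chi>\<^sup>r\<close>, which maps the invariant vector field of \<open>n\<close> to \<open>\<chi>\<^sup>r\<close> times that of
  \<open>\<phi>(n)\<close>, has degree \<open>r\<close> and not \<open>-r\<close>.\<close>

definition torus :: "(complex ^ 3) set" where
  "torus = {t. \<forall>i. t $ i \<noteq> 0}"

definition torus_inv :: "complex ^ 3 \<Rightarrow> complex ^ 3" where
  "torus_inv t = (\<chi> i. inverse (t $ i))"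

definition character :: "M \<Rightarrow> complex ^ 3 \<Rightarrow> complex" where
  "character m t = (\<Prod>i\<in>UNIV. t $ i powi (vec_of_M m $ i))"

definition act :: "complex ^ 3 \<Rightarrow> CM \<Rightarrow> CM" where
  "act t f = (\<Sum>m\<in>Poly_Mapping.keys f. Poly_Mapping.single m (character m t * Poly_Mapping.lookup f m))"

definition act_Der :: "complex ^ 3 \<Rightarrow> (CM \<Rightarrow> CM) \<Rightarrow> (CM \<Rightarrow> CM)" where
  "act_Der t D = (\<lambda>f. act t (D (act (torus_inv t) f)))"

definition act_Der2 :: "complex ^ 3 \<Rightarrow> (CM \<Rightarrow> CM \<Rightarrow> CM) \<Rightarrow> (CM \<Rightarrow> CM \<Rightarrow> CM)" where
  "act_Der2 t \<Psi> = (\<lambda>f g. act t (\<Psi> (act (torus_inv t) f) (act (torus_inv t) g)))"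

definition homogeneous :: "M \<Rightarrow> field \<Rightarrow> bool" where
  "homogeneous r \<Phi> \<longleftrightarrow> (\<forall>I\<in>fan. \<forall>t\<in>torus. \<forall>D\<in>Der I.
     act_Der2 t (\<Phi> I D) = (\<lambda>f g. const (character r t) * \<Phi> I (act_Der t D) f g))"

definition nonzero_field :: "field \<Rightarrow> bool" where
  "nonzero_field \<Phi> \<longleftrightarrow> (\<exists>I\<in>fan. \<exists>D\<in>Der I. \<exists>f g. \<Phi> I D f g \<noteq> 0)"

definition admissible :: "M \<Rightarrow> bool" where
  "admissible r \<longleftrightarrow> (\<exists>\<Phi>. pre_higgs \<Phi> \<and> homogeneous r \<Phi> \<and> nonzero_field \<Phi>)"

definition higgs_range :: "(real ^ 3) set" where
  "higgs_range = convex hull (real_M ` {r. admissible r})"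

section \<open>The associated linear maps\<close>

text \<open>An element of \<open>N\<^sub>\<complex> \<otimes> N\<^sub>\<complex>\<close> is represented by the biadditive form on \<open>M\<close> it induces, that
  is, \<open>n \<otimes> n'\<close> is \<open>(m, m') \<mapsto> \<langle>m, n\<rangle> \<langle>m', n'\<rangle>\<close>; this is an isomorphism onto all biadditive
  forms \<open>M \<times> M \<rightarrow> \<complex>\<close>.\<close>

type_synonym hom_N_NN = "complex lat \<Rightarrow> (M \<Rightarrow> M \<Rightarrow> complex)"

definition value_at_1 :: "CM \<Rightarrow> complex" where
  "value_at_1 f = (\<Sum>m\<in>Poly_Mapping.keys f. Poly_Mapping.lookup f m)"

text \<open>The identification of the fibre at \<open>1\<close> with \<open>N\<^sub>\<complex>\<close> sends the class of a vector field \<open>D\<close> to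
  the \<open>n\<close> with \<open>D(\<chi>\<^sup>m)(1) = \<langle>m, n\<rangle>\<close> for all \<open>m\<close>.\<close>

definition is_fibre :: "(CM \<Rightarrow> CM) \<Rightarrow> complex lat \<Rightarrow> bool" where
  "is_fibre D n \<longleftrightarrow> (\<forall>m. value_at_1 (D (chi m)) = pair m n)"

definition fibre2 :: "(CM \<Rightarrow> CM \<Rightarrow> CM) \<Rightarrow> (M \<Rightarrow> M \<Rightarrow> complex)" where
  "fibre2 \<Psi> = (\<lambda>m m'. value_at_1 (\<Psi> (chi m) (chi m')))"

text \<open>\<open>\<phi>\<close> is the map of fibres at \<open>1\<close> induced by \<open>\<Phi>\<close>; the torus is the chart of the cone \<open>{}\<close>.\<close>

definition associated :: "field \<Rightarrow> hom_N_NN \<Rightarrow> bool" where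
  "associated \<Phi> \<phi> \<longleftrightarrow> (\<forall>D\<in>Der {}. \<forall>n. is_fibre D n \<longrightarrow> \<phi> n = fibre2 (\<Phi> {} D))"

definition V :: "M \<Rightarrow> hom_N_NN set" where
  "V r = {\<phi>. \<exists>\<Phi>. pre_higgs \<Phi> \<and> homogeneous r \<Phi> \<and> associated \<Phi> \<phi>}"

text \<open>The endomorphism \<open>\<phi>\<^sub>s = (id \<otimes> s) \<circ> \<phi>\<close>.\<close>

definition contract :: "hom_N_NN \<Rightarrow> M \<Rightarrow> complex lat \<Rightarrow> complex lat" where
  "contract \<phi> s = (\<lambda>n. THE k. \<forall>m. pair m k = \<phi> n m s)"

lemma lat_decompose:
  "n = scale_lat (pair (mpt (-1) 1 0) n) (ray 1) + scale_lat (pair (mpt (-1) 0 1) n) (ray 2)"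
proof -
  have "n = scale_lat (pair m n) (ray 1) + scale_lat (pair m' n) (ray 2)"
    if "vec_of_M m = (\<chi> i. if i = 0 then -1 else if i = 1 then 1 else 0)"
      "vec_of_M m' = (\<chi> i. if i = 0 then -1 else if i = 1 then 0 else 1)" for m m'
    using that
  proof (transfer, goal_cases)
    case (1 m m' n)
    then show ?case
      by (intro exI[of _ "n $ 0"]) (simp add: forall_3' sum_3' axis_def)
  qed
  then show ?thesis by (simp add: vec_of_mpt)
qed

lemma pair_eqI: "k = l" if "\<And>m. pair m k = pair m l"
  by (subst lat_decompose, subst (2) lat_decompose) (simp only: that)

lemma NC_basis:
  "ray 1 \<noteq> (ray 2 :: complex lat)"
  "NC.independent {ray 1, ray 2}"
  "NC.span {ray 1, ray 2} = UNIV"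
proof -
  have p: "pair (mpt (-1) 1 0) (ray 1 :: complex lat) = 1"
    "pair (mpt (-1) 1 0) (ray 2 :: complex lat) = 0"
    "pair (mpt (-1) 0 1) (ray 1 :: complex lat) = 0"
    by (simp_all add: pair_ray vec_of_mpt)
  show ne: "ray 1 \<noteq> (ray 2 :: complex lat)" using p by auto
  have "ray 2 \<noteq> (0 :: complex lat)"
    using pair_zero[of "mpt (-1) 0 1", where ?'a = complex]
    by (auto simp: pair_ray vec_of_mpt dest!: arg_cong[of "ray 2" _ "pair (mpt (-1) 0 1)"])
  moreover have "ray 1 \<notin> NC.span {ray 2}"
    using p by (auto simp: NC.span_singleton pair_scale dest!: arg_cong[of "ray 1" _ "pair (mpt (-1) 1 0)"])
  ultimately show "NC.independent {ray 1, ray 2}"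
    by (simp add: NC.independent_insert ne)
  have "n \<in> NC.span {ray 1, ray 2}" for n
    by (subst lat_decompose) (intro NC.span_add NC.span_scale NC.span_base; simp)
  then show "NC.span {ray 1, ray 2} = UNIV" by blast
qed

definition trace_N :: "(complex lat \<Rightarrow> complex lat) \<Rightarrow> complex" where
  "trace_N h = (\<Sum>b\<in>{ray 1, ray 2}. NC.representation {ray 1, ray 2} (h b) b)"

definition V0 :: "M \<Rightarrow> hom_N_NN set" where
  "V0 r = {\<phi> \<in> V r. \<forall>s. trace_N (contract \<phi> s) = 0}"

definition scale_hom :: "complex \<Rightarrow> hom_N_NN \<Rightarrow> hom_N_NN" where
  "scale_hom c \<phi> = (\<lambda>n m m'. c * \<phi> n m m')"

global_interpretation Hom_N: vector_space scale_hom
  by standard (auto simp: scale_hom_def fun_eq_iff algebra_simps)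

section \<open>The distinguished degrees\<close>

definition r_vertex :: "3 \<Rightarrow> M" where
  "r_vertex \<nu> = (if \<nu> = 0 then mpt (-2) 1 1 else if \<nu> = 1 then mpt 1 (-2) 1 else mpt 1 1 (-2))"

definition s_vertex :: "3 \<Rightarrow> M" where
  "s_vertex \<nu> = (if \<nu> = 0 then mpt 0 1 (-1) else if \<nu> = 1 then mpt (-1) 0 1 else mpt 1 (-1) 0)"

end

theory Submission
  imports Defs
begin

text \<open>
  Write \<open>\<rho>\<^sub>l\<close> for \<open>ray l\<close> and \<open>m\<^sub>l\<close> for the coordinate \<open>\<langle>m, \<rho>\<^sub>l\<rangle>\<close> of \<open>m \<in> M\<close>. On the torus the tangent
  sheaf is free on the invariant vector fields \<open>\<partial>\<^sub>n\<close> (here \<open>der n\<close>), so a homogeneous field of degree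
  \<open>r\<close> is determined by a trilinear map \<open>\<phi>\<close>: it sends \<open>\<partial>\<^sub>n\<close> to the biderivation with
  values \<open>\<phi> n m m' \<cdot> chi (r + m + m')\<close> at the pairs \<open>(chi m, chi m')\<close>. The question is which \<open>\<phi>\<close> extend to \<open>\<P>\<^sup>2\<close>. A field extends as soon
  as it extends across the generic points of the three boundary lines, and along the line of
  \<open>\<rho>\<^sub>l\<close> only pole orders count: \<open>\<partial>\<^sub>n\<close> stays regular after division by the local equation exactly
  when \<open>n\<close> is a multiple of \<open>\<rho>\<^sub>l\<close>. This gives one inequality for each \<open>l\<close>,
  \<open>[n = \<rho>\<^sub>l] \<le> r\<^sub>l + [m\<^sub>l \<noteq> 0] + [m'\<^sub>l \<noteq> 0]\<close>  whenever  \<open>\<phi> n m m' \<noteq> 0\<close>,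
  the predicate \<open>pole_bound\<close>; that \<open>V r\<close> consists of the trilinear maps with this property is
  lemma \<open>V_eq\<close>.

  Everything else is linear algebra. Fix an index \<open>p\<close>; the \<open>\<rho>\<^sub>k\<close> with \<open>k \<noteq> p\<close> form a basis of \<open>N\<close>, and
  \<open>ediff p k\<close> is the dual basis. If some coefficient of \<open>\<phi>\<close> in it is nonzero, adding the inequalities
  of the two rays \<open>l \<noteq> p\<close> gives \<open>1 \<le> - r\<^sub>p + 2\<close>. So admissible degrees satisfy \<open>r\<^sub>p \<le> 1\<close> for all \<open>p\<close>,
  and these inequalities cut out the triangle with vertices \<open>r\<^sup>0, r\<^sup>1, r\<^sup>2\<close>. At a vertex, \<open>r\<^sub>\<nu> = -2\<close> forces
  \<open>m\<^sub>\<nu> \<noteq> 0\<close> and \<open>m'\<^sub>\<nu> \<noteq> 0\<close> wherever \<open>\<phi> n m m' \<noteq> 0\<close>; as \<open>s\<^sup>\<nu>\<close> has \<open>\<nu>\<close>-coordinate 0, the contraction with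
  \<open>s\<^sup>\<nu>\<close> vanishes, and only one coefficient of \<open>\<phi>\<close> survives. At a degree with coordinates \<open>-1, 0, 1\<close> three
  coefficients survive and the trace removes one of them; in degree 0 the three rays impose three
  relations on the eight coefficients and the trace two more.
\<close>

section \<open>Bases of the lattices and trilinear maps\<close>

abbreviation crd :: "M \<Rightarrow> 3 \<Rightarrow> int" where
  "crd m i \<equiv> vec_of_M m $ i"

lemma crd_zero [simp]: "crd 0 i = 0"
  by (simp add: zero_M.rep_eq)

lemma crd_add [simp]: "crd (m + m') i = crd m i + crd m' i"
  by (simp add: plus_M.rep_eq)

lemma crd_diff [simp]: "crd (m - m') i = crd m i - crd m' i"
  by (simp add: minus_M.rep_eq)

lemma crd_uminus [simp]: "crd (- m) i = - crd m i"
  by (simp add: uminus_M.rep_eq)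

lemma M_eqI: "(\<And>i. crd m i = crd m' i) \<Longrightarrow> m = m'"
  by (simp add: vec_of_M_inject[symmetric] vec_eq_iff)

lemma sum_crd: "(\<Sum>i\<in>UNIV. crd m i) = 0"
  using vec_of_M[of m] by simp

text \<open>The difference \<open>e\<^sub>k - e\<^sub>p\<close> of standard basis vectors. For a fixed index \<open>p\<close> and \<open>k \<noteq> p\<close> these are the
  basis of \<open>M\<close> dual to the rays other than \<open>\<rho>\<^sub>p\<close>, so \<open>p\<close> names one of the three maximal cones by the
  ray that it omits. Because \<open>ediff p p = 0\<close>, sums over the two basis vectors can be
  written as sums over all three indices, and changing \<open>p\<close> shifts all of them by the same element
  (\<open>ediff_change\<close>).\<close>

lift_definition ediff :: "3 \<Rightarrow> 3 \<Rightarrow> M" is "\<lambda>p k. axis k 1 - axis p 1"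
  by (simp add: sum_subtractf axis_def)

lemma crd_ediff [simp]: "crd (ediff p k) l = of_bool (l = k) - of_bool (l = p)"
  by (simp add: ediff.rep_eq axis_def)

lemma ediff_self [simp]: "ediff p p = 0"
  by (rule M_eqI) simp

lemma ediff_change: "ediff p k = ediff p q + ediff q k"
  by (rule M_eqI) simp

lift_definition zmul :: "int \<Rightarrow> M \<Rightarrow> M" is "\<lambda>z m. \<chi> i. z * m $ i"
  by (simp flip: sum_distrib_left)

lemma crd_zmul [simp]: "crd (zmul z m) i = z * crd m i"
  by (simp add: zmul.rep_eq)

definition dual_cone :: "3 set \<Rightarrow> M set" where
  "dual_cone I = {m. \<forall>i\<in>I. 0 \<le> crd m i}"

lemma dual_cone_add: "m \<in> dual_cone I \<Longrightarrow> m' \<in> dual_cone I \<Longrightarrow> m + m' \<in> dual_cone I"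
  by (simp add: dual_cone_def)

lemma dual_cone_zero [simp]: "0 \<in> dual_cone I"
  by (simp add: dual_cone_def)

lemma dual_cone_empty [simp]: "dual_cone {} = UNIV"
  by (simp add: dual_cone_def)

lemma ediff_in_dual_cone: "p \<notin> I \<Longrightarrow> ediff p k \<in> dual_cone I"
  by (auto simp: dual_cone_def)

lemma M_frame: "m = (\<Sum>k\<in>UNIV. zmul (crd m k) (ediff p k))"
proof (rule M_eqI)
  fix l
  have "crd (\<Sum>k\<in>UNIV. zmul (crd m k) (ediff p k)) l
      = (\<Sum>k\<in>UNIV. crd m k * (of_bool (l = k) - of_bool (l = p)))"
    by (simp add: sum_3')
  also have "\<dots> = (\<Sum>k\<in>UNIV. crd m k * of_bool (l = k)) - (\<Sum>k\<in>UNIV. crd m k) * of_bool (l = p)"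
    by (simp add: right_diff_distrib sum_subtractf sum_distrib_right)
  also have "\<dots> = crd m l"
    by (simp add: sum_crd of_bool_def if_distrib cong: if_cong)
  finally show "crd m l = crd (\<Sum>k\<in>UNIV. zmul (crd m k) (ediff p k)) l" by simp
qed

text \<open>Coordinates in the basis \<open>ediff p\<close>, for a map that is additive only on the semigroup of a cone \<open>I\<close>
  of the fan. Coordinates \<open>m\<^sub>k\<close> with \<open>k \<in> I\<close> are nonnegative on the semigroup, and for the other
  \<open>k\<close> it also contains \<open>- ediff p k\<close>; so every multiple that occurs stays inside. The general form serves
  logarithmic derivatives on the charts, the case \<open>I = {}\<close> the forms on \<open>M\<close>.\<close>

lemma additive_on_cone_frame:
  fixes A :: "M \<Rightarrow> 'a::comm_ring_1"
  assumes add: "\<And>m m'. m \<in> dual_cone I \<Longrightarrow> m' \<in> dual_cone I \<Longrightarrow> A (m + m') = A m + A m'"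
    and p: "p \<notin> I" and m: "m \<in> dual_cone I"
  shows "A m = (\<Sum>k\<in>UNIV. of_int (crd m k) * A (ediff p k))"
proof -
  have A0: "A 0 = 0"
    using add[of 0 0] by simp
  have nat: "A (zmul (int z) e) = of_int (int z) * A e \<and> zmul (int z) e \<in> dual_cone I" if e: "e \<in> dual_cone I" for z e
  proof (induction z)
    case 0
    have "zmul 0 e = 0" by (rule M_eqI) simp
    then show ?case using A0 by simp
  next
    case (Suc z)
    have "zmul (int (Suc z)) e = zmul (int z) e + e"
      by (rule M_eqI) (simp add: algebra_simps)
    then show ?case
      using Suc add[of "zmul (int z) e" e] e by (simp add: algebra_simps dual_cone_add)
  qed
  have scale: "A (zmul z (ediff p k)) = of_int z * A (ediff p k) \<and> zmul z (ediff p k) \<in> dual_cone I"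
    if "k \<in> I \<Longrightarrow> 0 \<le> z" for z k
  proof (cases "0 \<le> z")
    case True
    then show ?thesis using nat[OF ediff_in_dual_cone[OF p], of "nat z" k] by simp
  next
    case False
    then have "k \<notin> I" using that by auto
    then have "zmul z (ediff p k) \<in> dual_cone I"
      using p by (auto simp: dual_cone_def)
    moreover have "A (zmul (- z) (ediff p k)) = of_int (- z) * A (ediff p k)
        \<and> zmul (- z) (ediff p k) \<in> dual_cone I"
      using nat[OF ediff_in_dual_cone[OF p], of "nat (- z)" k] False by simp
    moreover have "zmul z (ediff p k) + zmul (- z) (ediff p k) = 0"
      by (rule M_eqI) simp
    ultimately have "A (zmul z (ediff p k)) + of_int (- z) * A (ediff p k) = 0"
      using add[of "zmul z (ediff p k)" "zmul (- z) (ediff p k)"] A0 by simp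
    then show ?thesis
      using \<open>zmul z (ediff p k) \<in> dual_cone I\<close> by (simp add: algebra_simps)
  qed
  have sc: "A (zmul (crd m k) (ediff p k)) = of_int (crd m k) * A (ediff p k)"
    and inc: "zmul (crd m k) (ediff p k) \<in> dual_cone I" for k
    using scale[of k "crd m k"] m by (auto simp: dual_cone_def)
  have "A m = A (\<Sum>k\<in>UNIV. zmul (crd m k) (ediff p k))"
    by (subst M_frame[of m p]) (rule refl)
  also have "\<dots> = (\<Sum>k\<in>UNIV. A (zmul (crd m k) (ediff p k)))"
    unfolding sum_3' using inc by (simp add: add dual_cone_add)
  finally show ?thesis by (simp add: sc)
qed

lemma additive_frame:
  fixes A :: "M \<Rightarrow> 'a::comm_ring_1"
  assumes "\<And>m m'. A (m + m') = A m + A m'"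
  shows "A m = (\<Sum>k\<in>UNIV. of_int (crd m k) * A (ediff p k))"
  by (rule additive_on_cone_frame[where I = "{}"]) (auto intro: assms)

lemma pair_add_left: "pair (m + m') n = pair m n + pair m' n"
  by transfer (simp add: algebra_simps sum.distrib)

lemma pair_zero_left [simp]: "pair 0 n = 0"
  by transfer simp

lemma sum_ray: "(\<Sum>k\<in>UNIV. ray k) = (0 :: 'a::comm_ring_1 lat)"
  unfolding sum_3'
  by transfer (simp add: forall_3' axis_def)

lemma pair_ediff_ray [simp]: "pair (ediff p k) (ray l) = (of_bool (l = k) - of_bool (l = p) :: 'a::comm_ring_1)"
  by (simp add: pair_ray)

lemma lat_frame: "n = (\<Sum>k\<in>UNIV. scale_lat (pair (ediff p k) n) (ray k))"
proof (rule pair_eqI)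
  fix m
  have "pair m n = (\<Sum>k\<in>UNIV. of_int (crd m k) * pair (ediff p k) n)"
    by (rule additive_frame) (rule pair_add_left)
  then show "pair m n = pair m (\<Sum>k\<in>UNIV. scale_lat (pair (ediff p k) n) (ray k))"
    by (simp add: sum_3' pair_add pair_scale pair_ray mult.commute)
qed

lemma linear_on_lat_frame:
  fixes B :: "complex lat \<Rightarrow> complex"
  assumes add: "\<And>n n'. B (n + n') = B n + B n'" and scale: "\<And>c n. B (scale_lat c n) = c * B n"
  shows "B n = (\<Sum>k\<in>UNIV. pair (ediff p k) n * B (ray k))"
  by (subst lat_frame[of n p]) (simp add: sum_3' add scale)

text \<open>The relation \<open>\<rho>\<^sub>0 + \<rho>\<^sub>1 + \<rho>\<^sub>2 = 0\<close> is what makes the formulas in the bases \<open>ediff p\<close> independent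
  of \<open>p\<close>.\<close>

lemma linear_sum_ray:
  fixes B :: "complex lat \<Rightarrow> complex"
  assumes add: "\<And>n n'. B (n + n') = B n + B n'"
  shows "(\<Sum>k\<in>UNIV. B (ray k)) = 0"
proof -
  have "B 0 = 0" using add[of 0 0] by simp
  moreover have "B (\<Sum>k\<in>UNIV. ray k) = (\<Sum>k\<in>UNIV. B (ray k))"
    by (simp add: sum_3' add)
  ultimately show ?thesis by (simp add: sum_ray)
qed

definition trilinear :: "hom_N_NN \<Rightarrow> bool" where
  "trilinear \<phi> \<longleftrightarrow> (\<forall>n n' m m'. \<phi> (n + n') m m' = \<phi> n m m' + \<phi> n' m m')
     \<and> (\<forall>c n m m'. \<phi> (scale_lat c n) m m' = c * \<phi> n m m')
     \<and> (\<forall>n m1 m2 m'. \<phi> n (m1 + m2) m' = \<phi> n m1 m' + \<phi> n m2 m')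
     \<and> (\<forall>n m m1 m2. \<phi> n m (m1 + m2) = \<phi> n m m1 + \<phi> n m m2)"

text \<open>The inequality that a homogeneous field of degree \<open>r\<close> has to satisfy along the three boundary lines.
  Contracting with \<open>m\<close> can compensate a pole along the line of \<open>\<rho>\<^sub>l\<close> only if \<open>m\<^sub>l \<noteq> 0\<close>, and one more
  order is needed if the argument is \<open>\<rho>\<^sub>l\<close>, because the vector field of \<open>\<rho>\<^sub>l\<close>
  vanishes on that line. The use of indicators instead of the values \<open>m\<^sub>l\<close> frees the condition
  from any choice of basis.\<close>

definition pole_bound :: "M \<Rightarrow> hom_N_NN \<Rightarrow> bool" where
  "pole_bound r \<phi> \<longleftrightarrow> (\<forall>l n m m'. \<phi> n m m' \<noteq> 0 \<longrightarrow>
     of_bool (n = ray l) \<le> crd r l + of_bool (crd m l \<noteq> 0) + of_bool (crd m' l \<noteq> 0))"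

lemma trilinear_frame_left:
  "trilinear \<phi> \<Longrightarrow> \<phi> n m m' = (\<Sum>k\<in>UNIV. of_int (crd m k) * \<phi> n (ediff p k) m')"
  by (rule additive_frame[of "\<lambda>m. \<phi> n m m'"]) (simp add: trilinear_def)

lemma trilinear_frame_right:
  "trilinear \<phi> \<Longrightarrow> \<phi> n m m' = (\<Sum>k\<in>UNIV. of_int (crd m' k) * \<phi> n m (ediff p k))"
  by (rule additive_frame[of "\<lambda>m'. \<phi> n m m'"]) (simp add: trilinear_def)

lemma trilinear_frame_N:
  "trilinear \<phi> \<Longrightarrow> \<phi> n m m' = (\<Sum>k\<in>UNIV. pair (ediff p k) n * \<phi> (ray k) m m')"
  by (rule linear_on_lat_frame[of "\<lambda>n. \<phi> n m m'"]) (simp_all add: trilinear_def)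

lemma trilinear_sum_ray: "trilinear \<phi> \<Longrightarrow> (\<Sum>k\<in>UNIV. \<phi> (ray k) m m') = 0"
  by (rule linear_sum_ray[of "\<lambda>n. \<phi> n m m'"]) (simp add: trilinear_def)

lemma trilinear_zero:
  assumes "trilinear \<phi>"
  shows "\<phi> n 0 m' = 0" "\<phi> n m 0 = 0"
proof -
  have "\<phi> n (0 + 0) m' = \<phi> n 0 m' + \<phi> n 0 m'" "\<phi> n m (0 + 0) = \<phi> n m 0 + \<phi> n m 0"
    using assms unfolding trilinear_def by blast+
  then show "\<phi> n 0 m' = 0" "\<phi> n m 0 = 0" by simp_all
qed

lemma trilinear_frame:
  assumes "trilinear \<phi>"
  shows "\<phi> n m m' = (\<Sum>k\<in>UNIV. \<Sum>a\<in>UNIV. \<Sum>b\<in>UNIV.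
    pair (ediff p k) n * of_int (crd m a) * of_int (crd m' b) * \<phi> (ray k) (ediff p a) (ediff p b))"
proof -
  have "\<phi> n m m' = (\<Sum>k\<in>UNIV. pair (ediff p k) n * (\<Sum>a\<in>UNIV. of_int (crd m a)
      * (\<Sum>b\<in>UNIV. of_int (crd m' b) * \<phi> (ray k) (ediff p a) (ediff p b))))"
    by (subst trilinear_frame_N[OF assms, of _ _ _ p], subst trilinear_frame_left[OF assms, of _ _ _ p],
        subst trilinear_frame_right[OF assms, of _ _ _ p]) (rule refl)
  then show ?thesis
    by (simp add: sum_distrib_left mult.assoc)
qed

section \<open>Charts, diagonal operators and the torus action\<close>

lemma chart_iff_keys: "f \<in> chart I \<longleftrightarrow> Poly_Mapping.keys f \<subseteq> dual_cone I"
  by (auto simp: chart_def dual_cone_def pair_ray)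

lemma chart_empty [simp]: "chart {} = UNIV"
  by (auto simp: chart_def)

lemma chart_zero [simp]: "0 \<in> chart I"
  by (simp add: chart_iff_keys)

lemma chart_single: "m \<in> dual_cone I \<Longrightarrow> Poly_Mapping.single m c \<in> chart I"
  by (auto simp: chart_iff_keys)

text \<open>Identities between additive maps on a chart need to be checked on monomials only.\<close>

lemma chart_induct [consumes 1, case_names single add]:
  assumes f: "f \<in> chart I"
    and single: "\<And>m c. m \<in> dual_cone I \<Longrightarrow> P (Poly_Mapping.single m c)"
    and add: "\<And>f g. f \<in> chart I \<Longrightarrow> g \<in> chart I \<Longrightarrow> P f \<Longrightarrow> P g \<Longrightarrow> P (f + g)"
  shows "P f"
proof -
  have "f \<in> chart I \<longrightarrow> P f"
  proof (induction f rule: update_induct)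
    case const
    show ?case using single[of 0 0] by simp
  next
    case (update f a b)
    have eq: "Poly_Mapping.update a b f = f + Poly_Mapping.single a b"
      using update(1) by (intro poly_mapping_eqI) (auto simp: lookup_update lookup_add lookup_single when_def in_keys_iff)
    have keys: "Poly_Mapping.keys (Poly_Mapping.update a b f) = insert a (Poly_Mapping.keys f)"
      using update(1,2) by (simp add: keys_update)
    show ?case
    proof
      assume "Poly_Mapping.update a b f \<in> chart I"
      then have "a \<in> dual_cone I" "f \<in> chart I"
        by (auto simp: keys chart_iff_keys)
      then show "P (Poly_Mapping.update a b f)"
        using update(3) by (simp add: eq add single chart_single)
    qed
  qed
  then show ?thesis using f by simp
qed

lemma CM_induct [case_names single add]:
  fixes f :: CM
  assumes "\<And>m c. P (Poly_Mapping.single m c)" "\<And>f g. P f \<Longrightarrow> P g \<Longrightarrow> P (f + g)"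
  shows "P f"
  using chart_induct[of f "{}" P] assms by simp

text \<open>Invariant vector fields and the torus action are both diagonal in the monomial basis; an additive weight
  gives a derivation and a multiplicative one a ring homomorphism.\<close>

definition diag :: "(M \<Rightarrow> complex) \<Rightarrow> CM \<Rightarrow> CM" where
  "diag w f = Poly_Mapping.mapp (\<lambda>m c. w m * c) f"

lemma lookup_diag [simp]: "Poly_Mapping.lookup (diag w f) m = w m * Poly_Mapping.lookup f m"
  by (simp add: diag_def lookup_mapp when_def in_keys_iff)

lemma diag_single [simp]: "diag w (Poly_Mapping.single m c) = Poly_Mapping.single m (w m * c)"
  by (rule poly_mapping_eqI) (simp add: lookup_single when_def)

lemma diag_add: "diag w (f + g) = diag w f + diag w g"
  by (rule poly_mapping_eqI) (simp add: lookup_add algebra_simps)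

lemma diag_zero [simp]: "diag w 0 = 0"
  by (rule poly_mapping_eqI) simp

lemma diag_diag: "diag w (diag v f) = diag (\<lambda>m. w m * v m) f"
  by (rule poly_mapping_eqI) (simp add: algebra_simps)

lemma diag_one: "diag (\<lambda>m. 1) f = f"
  by (rule poly_mapping_eqI) simp

lemma keys_diag: "Poly_Mapping.keys (diag w f) \<subseteq> Poly_Mapping.keys f"
  by (auto simp: in_keys_iff)

lemma diag_hom:
  assumes "\<And>m m'. w (m + m') = w m * w m'"
  shows "diag w (f * g) = diag w f * diag w g"
proof (induction f rule: CM_induct)
  case (single m c)
  show ?case
    by (induction g rule: CM_induct) (simp_all add: mult_single assms distrib_left diag_add algebra_simps)
qed (simp add: distrib_right diag_add)

lemma diag_leibniz:
  assumes "\<And>m m'. w (m + m') = w m + w m'"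
  shows "diag w (f * g) = diag w f * g + f * diag w g"
proof (induction f rule: CM_induct)
  case (single m c)
  show ?case
    by (induction g rule: CM_induct)
       (simp_all add: mult_single assms distrib_left diag_add algebra_simps flip: single_add)
qed (simp add: distrib_right diag_add algebra_simps)

definition der :: "complex lat \<Rightarrow> CM \<Rightarrow> CM" where
  "der n = diag (\<lambda>m. pair m n)"

lemma der_single [simp]: "der n (Poly_Mapping.single m c) = Poly_Mapping.single m (pair m n * c)"
  by (simp add: der_def)

lemma der_add: "der n (f + g) = der n f + der n g"
  by (simp add: der_def diag_add)

lemma der_leibniz: "der n (f * g) = der n f * g + f * der n g"
  unfolding der_def by (rule diag_leibniz) (rule pair_add_left)

lemma der_add_left: "der (n + n') f = der n f + der n' f"
  by (rule poly_mapping_eqI) (simp add: der_def pair_add lookup_add algebra_simps)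

lemma der_scale_left: "der (scale_lat c n) f = const c * der n f"
proof (induction f rule: CM_induct)
  case (single m d)
  show ?case by (simp add: mult_single pair_scale mult.assoc)
qed (simp add: der_add distrib_left)

lemma character_add: "t \<in> torus \<Longrightarrow> character (m + m') t = character m t * character m' t"
  by (simp add: character_def torus_def power_int_add prod.distrib)

lemma character_zero [simp]: "character 0 t = 1"
  by (simp add: character_def)

lemma character_torus_inv: "character m (torus_inv t) = inverse (character m t)"
  by (simp add: character_def torus_inv_def power_int_inverse prod_inversef [symmetric] o_def)

lemma character_nonzero: "t \<in> torus \<Longrightarrow> character m t \<noteq> 0"
  by (simp add: character_def torus_def)

lemma characters_separate:
  assumes "m \<noteq> m'"
  shows "\<exists>t\<in>torus. character m t \<noteq> character m' t"
proof -
  obtain i where i: "crd m i \<noteq> crd m' i"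
    using assms M_eqI by blast
  \<comment> \<open>The number 2 is not a root of unity, so its powers tell the exponents apart.\<close>
  define t :: "complex ^ 3" where "t = (\<chi> j. if j = i then 2 else 1)"
  have ch: "character l t = 2 powi crd l i" for l
  proof -
    have "character l t = (\<Prod>j\<in>UNIV. if j = i then 2 powi crd l i else 1)"
      unfolding character_def t_def by (rule prod.cong) auto
    then show ?thesis by simp
  qed
  have "(2 :: complex) powi crd m i \<noteq> 2 powi crd m' i"
  proof
    assume "(2 :: complex) powi crd m i = 2 powi crd m' i"
    then have "norm ((2 :: complex) powi crd m i) = norm ((2 :: complex) powi crd m' i)" by simp
    then have "(2 :: real) powi crd m i = 2 powi crd m' i" by (simp add: norm_power_int)
    then show False
      using i power_int_strict_increasing[of "crd m i" "crd m' i" "2 :: real"]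
        power_int_strict_increasing[of "crd m' i" "crd m i" "2 :: real"]
      by (cases "crd m i < crd m' i") auto
  qed
  moreover have "t \<in> torus" by (simp add: torus_def t_def)
  ultimately show ?thesis
    by (intro bexI[of _ t]) (simp_all add: ch)
qed

lemma act_eq_diag: "act t = diag (\<lambda>m. character m t)"
proof
  fix f
  show "act t f = diag (\<lambda>m. character m t) f"
  proof (rule poly_mapping_eqI)
    fix m
    have "Poly_Mapping.lookup (act t f) m = (\<Sum>l\<in>Poly_Mapping.keys f.
        if l = m then character m t * Poly_Mapping.lookup f m else 0)"
      unfolding act_def lookup_sum by (rule sum.cong) (auto simp: lookup_single when_def)
    then show "Poly_Mapping.lookup (act t f) m = Poly_Mapping.lookup (diag (\<lambda>m. character m t) f) m"
      by (simp add: in_keys_iff)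
  qed
qed

lemma act_mult: "t \<in> torus \<Longrightarrow> act t (f * g) = act t f * act t g"
  unfolding act_eq_diag by (rule diag_hom) (rule character_add)

lemma act_add: "act t (f + g) = act t f + act t g"
  by (simp add: act_eq_diag diag_add)

lemma act_single [simp]: "act t (Poly_Mapping.single m c) = Poly_Mapping.single m (character m t * c)"
  by (simp add: act_eq_diag)

lemma act_inverse: "t \<in> torus \<Longrightarrow> act t (act (torus_inv t) f) = f"
  by (simp add: act_eq_diag diag_diag character_torus_inv character_nonzero diag_one)

lemma act_inverse': "t \<in> torus \<Longrightarrow> act (torus_inv t) (act t f) = f"
  by (simp add: act_eq_diag diag_diag character_torus_inv character_nonzero diag_one)

lemma act_der: "act t (der n f) = der n (act t f)"
  by (simp add: act_eq_diag der_def diag_diag mult.commute)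

lemma value_at_1_superset:
  assumes "finite S" "Poly_Mapping.keys f \<subseteq> S"
  shows "value_at_1 f = (\<Sum>m\<in>S. Poly_Mapping.lookup f m)"
  unfolding value_at_1_def using assms by (intro sum.mono_neutral_left) (auto simp: in_keys_iff)

lemma value_at_1_single [simp]: "value_at_1 (Poly_Mapping.single m c) = c"
  using value_at_1_superset[of "{m}" "Poly_Mapping.single m c"] by simp

lemma value_at_1_add: "value_at_1 (f + g) = value_at_1 f + value_at_1 g"
proof -
  define S where "S = Poly_Mapping.keys f \<union> Poly_Mapping.keys g"
  have S: "finite S" "Poly_Mapping.keys f \<subseteq> S" "Poly_Mapping.keys g \<subseteq> S"
      "Poly_Mapping.keys (f + g) \<subseteq> S"
    using keys_add[of f g] by (auto simp: S_def)
  show ?thesis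
    unfolding value_at_1_superset[OF S(1,2)] value_at_1_superset[OF S(1,3)]
      value_at_1_superset[OF S(1,4)] by (simp add: lookup_add sum.distrib)
qed

lemma value_at_1_mult: "value_at_1 (f * g) = value_at_1 f * value_at_1 g"
proof (induction f rule: CM_induct)
  case (single m c)
  show ?case
    by (induction g rule: CM_induct) (simp_all add: mult_single distrib_left value_at_1_add algebra_simps)
qed (simp add: distrib_right value_at_1_add)

lemma value_at_1_zero [simp]: "value_at_1 0 = 0"
  by (simp add: value_at_1_def)

lemma value_at_1_sum: "value_at_1 (\<Sum>x\<in>A. f x) = (\<Sum>x\<in>A. value_at_1 (f x))"
  by (induction A rule: infinite_finite_induct) (simp_all add: value_at_1_add)

lemma chart_add: "f \<in> chart I \<Longrightarrow> g \<in> chart I \<Longrightarrow> f + g \<in> chart I"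
  using keys_add[of f g] by (auto simp: chart_iff_keys)

lemma chart_sum: "(\<And>x. x \<in> A \<Longrightarrow> f x \<in> chart I) \<Longrightarrow> (\<Sum>x\<in>A. f x) \<in> chart I"
  by (induction A rule: infinite_finite_induct) (auto intro: chart_add)

lemma chart_mult: "f \<in> chart I \<Longrightarrow> g \<in> chart I \<Longrightarrow> f * g \<in> chart I"
  using keys_mult[of f g] by (fastforce simp: chart_iff_keys intro: dual_cone_add)

lemma chart_diag: "f \<in> chart I \<Longrightarrow> diag w f \<in> chart I"
  using keys_diag[of w f] by (auto simp: chart_iff_keys)

lemma chart_act: "f \<in> chart I \<Longrightarrow> act t f \<in> chart I"
  by (simp add: act_eq_diag chart_diag)

lemma chart_mono: "J \<subseteq> I \<Longrightarrow> chart I \<subseteq> chart J"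
  by (auto simp: chart_def)

section \<open>Derivations and biderivations on a chart\<close>

text \<open>Extension by zero outside the chart, as sections of the tangent sheaf are represented.\<close>

definition restr :: "3 set \<Rightarrow> (CM \<Rightarrow> CM) \<Rightarrow> (CM \<Rightarrow> CM)" where
  "restr I D = (\<lambda>f. if f \<in> chart I then D f else 0)"

lemma const_mult_in_chart: "f \<in> chart I \<Longrightarrow> const c * f \<in> chart I"
  by (rule chart_mult) (simp_all add: chart_single)

lemma Der_outside: "D \<in> Der I \<Longrightarrow> f \<notin> chart I \<Longrightarrow> D f = 0"
  by (simp add: Der_def)

lemma Der_in_chart: "D \<in> Der I \<Longrightarrow> D f \<in> chart I"
  by (cases "f \<in> chart I") (simp_all add: Der_def)

lemma Der_add: "D \<in> Der I \<Longrightarrow> f \<in> chart I \<Longrightarrow> g \<in> chart I \<Longrightarrow> D (f + g) = D f + D g"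
  by (simp add: Der_def)

lemma Der_const_mult: "D \<in> Der I \<Longrightarrow> f \<in> chart I \<Longrightarrow> D (const c * f) = const c * D f"
  by (simp add: Der_def)

lemma Der_mult: "D \<in> Der I \<Longrightarrow> f \<in> chart I \<Longrightarrow> g \<in> chart I \<Longrightarrow> D (f * g) = D f * g + f * D g"
  by (simp add: Der_def)

lemma Der_single:
  assumes "D \<in> Der I" "m \<in> dual_cone I"
  shows "D (Poly_Mapping.single m c) = const c * D (chi m)"
  using Der_const_mult[OF assms(1) chart_single[OF assms(2), of 1], of c] by (simp add: mult_single)

lemma Der_mult_left: "a \<in> chart I \<Longrightarrow> D \<in> Der I \<Longrightarrow> (\<lambda>f. a * D f) \<in> Der I"
  unfolding Der_def by (auto simp: chart_mult distrib_left mult.left_commute mult.assoc)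


text \<open>The field \<open>\<chi>\<^sup>q \<partial>\<^sub>n\<close> may have a simple pole along the line of \<open>\<rho>\<^sub>l\<close> if \<open>n = \<rho>\<^sub>l\<close>: a monomial \<open>\<chi>\<^sup>m\<close> on which
  \<open>\<partial>\<^sub>n\<close> does not vanish has \<open>m\<^sub>l \<noteq> 0\<close>, hence \<open>m\<^sub>l \<ge> 1\<close>.\<close>

lemma restr_monomial_der_in_Der:
  assumes q: "\<And>l. l \<in> I \<Longrightarrow> 0 \<le> crd q l + of_bool (n = ray l)"
  shows "restr I (\<lambda>f. chi q * der n f) \<in> Der I"
proof -
  have key: "chi q * der n (Poly_Mapping.single m c) \<in> chart I" if m: "m \<in> dual_cone I" for m c
  proof (cases "pair m n = 0")
    case True
    then show ?thesis by simp
  next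
    case False
    have "q + m \<in> dual_cone I"
      unfolding dual_cone_def
    proof (clarsimp)
      fix l assume l: "l \<in> I"
      have "0 \<le> crd m l" using m l by (simp add: dual_cone_def)
      moreover have "crd m l \<noteq> 0" if "n = ray l" using False that by (simp add: pair_ray)
      ultimately show "0 \<le> crd q l + crd m l"
        using q[OF l] by (cases "n = ray l") auto
    qed
    then show ?thesis by (simp add: mult_single chart_single)
  qed
  have "chi q * der n f \<in> chart I" if "f \<in> chart I" for f
    using that
  proof (induction f rule: chart_induct)
    case (single m c)
    then show ?case by (rule key)
  qed (simp add: der_add distrib_left chart_add)
  then show ?thesis
    unfolding Der_def restr_def
    by (auto simp: chart_add chart_mult const_mult_in_chart der_add der_leibniz distrib_left
        mult.left_commute mult.assoc)
qed

lemma der_in_Der: "der n \<in> Der {}"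
  using restr_monomial_der_in_Der[of "{}" 0 n] by (simp add: restr_def)

text \<open>The logarithmic derivative \<open>D(\<chi>\<^sup>m) / \<chi>\<^sup>m\<close>; by the Leibniz rule it is additive in \<open>m\<close>.\<close>

definition log_der :: "(CM \<Rightarrow> CM) \<Rightarrow> M \<Rightarrow> CM" where
  "log_der D m = chi (- m) * D (chi m)"

lemma chi_cancel [simp]: "chi (- m) * chi m = 1" "chi m * chi (- m) = 1"
  by (simp_all add: mult_single)

lemma Der_chi: "D (chi m) = chi m * log_der D m"
  by (simp add: log_der_def flip: mult.assoc)

lemma log_der_add:
  assumes D: "D \<in> Der I" and m: "m \<in> dual_cone I" "m' \<in> dual_cone I"
  shows "log_der D (m + m') = log_der D m + log_der D m'"
proof -
  have "D (chi (m + m')) = D (chi m * chi m')" by (simp add: mult_single)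
  also have "\<dots> = D (chi m) * chi m' + chi m * D (chi m')"
    by (intro Der_mult[OF D] chart_single m)
  finally have "log_der D (m + m') = (chi (- m) * chi (- m')) * (D (chi m) * chi m' + chi m * D (chi m'))"
    by (simp add: log_der_def mult_single)
  also have "\<dots> = (chi (- m') * chi m') * (chi (- m) * D (chi m)) + (chi (- m) * chi m) * (chi (- m') * D (chi m'))"
    by (simp only: algebra_simps)
  also have "\<dots> = log_der D m + log_der D m'"
    by (simp only: chi_cancel log_der_def mult_1_left)
  finally show ?thesis .
qed

lemma log_der_frame:
  assumes "D \<in> Der I" "p \<notin> I" "m \<in> dual_cone I"
  shows "log_der D m = (\<Sum>k\<in>UNIV. of_int (crd m k) * log_der D (ediff p k))"
  by (rule additive_on_cone_frame[where I = I]) (use assms log_der_add in auto)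

text \<open>On the chart of a cone without the ray \<open>\<rho>\<^sub>p\<close> every derivation is a combination of the invariant fields
  \<open>\<partial>\<close> of the other two rays, with coefficients on the torus. It is therefore determined by its values on
  the monomials \<open>ediff p k\<close>, and the same formula extends it to the torus.\<close>

lemma Der_frame:
  assumes D: "D \<in> Der I" and p: "p \<notin> I" and f: "f \<in> chart I"
  shows "D f = (\<Sum>k\<in>UNIV. log_der D (ediff p k) * der (ray k) f)"
  using f
proof (induction f rule: chart_induct)
  case (single m c)
  have "D (Poly_Mapping.single m c) = const c * (chi m * log_der D m)"
    unfolding Der_chi[symmetric] by (rule Der_single[OF D single])
  also have "\<dots> = (\<Sum>k\<in>UNIV. log_der D (ediff p k) * (const c * (chi m * of_int (crd m k))))"
    unfolding log_der_frame[OF D p single] sum_distrib_left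
    by (intro sum.cong refl) (simp only: ac_simps)
  also have "\<dots> = (\<Sum>k\<in>UNIV. log_der D (ediff p k) * der (ray k) (Poly_Mapping.single m c))"
    by (simp only: single_of_int[symmetric] mult_single der_single pair_ray) (simp add: mult.commute)
  finally show ?case .
next
  case (add f g)
  show ?case
    unfolding Der_add[OF D add(1,2)] add(3,4) der_add distrib_left sum.distrib ..
qed

lemma Der2_zero: "(\<lambda>f g. 0) \<in> Der2 I"
  unfolding Der2_def by (rule CollectI) (intro exI[of _ 0], simp)

lemma Der2_mult: "D \<in> Der I \<Longrightarrow> E \<in> Der I \<Longrightarrow> (\<lambda>f g. D f * E g) \<in> Der2 I"
  unfolding Der2_def
  by (rule CollectI, intro exI[of _ 1] exI[of _ "\<lambda>_. D"] exI[of _ "\<lambda>_. E"]) simp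

lemma Der2_add:
  assumes "\<Psi> \<in> Der2 I" "\<Psi>' \<in> Der2 I"
  shows "(\<lambda>f g. \<Psi> f g + \<Psi>' f g) \<in> Der2 I"
proof -
  obtain k D E where 1: "\<forall>j<k. D j \<in> Der I \<and> E j \<in> Der I" "\<Psi> = (\<lambda>f g. \<Sum>j<(k::nat). D j f * E j g)"
    using assms(1) unfolding Der2_def by blast
  obtain k' D' E' where 2: "\<forall>j<k'. D' j \<in> Der I \<and> E' j \<in> Der I" "\<Psi>' = (\<lambda>f g. \<Sum>j<(k'::nat). D' j f * E' j g)"
    using assms(2) unfolding Der2_def by blast
  \<comment> \<open>Concatenate the two finite families.\<close>
  define D'' where "D'' j = (if j < k then D j else D' (j - k))" for j
  define E'' where "E'' j = (if j < k then E j else E' (j - k))" for j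
  have "(\<Sum>j<k + k'. D'' j f * E'' j g) = \<Psi> f g + \<Psi>' f g" for f g
  proof -
    have "(\<Sum>j<k + k'. D'' j f * E'' j g)
        = (\<Sum>j<k. D'' j f * E'' j g) + (\<Sum>j<k'. D'' (j + k) f * E'' (j + k) g)"
      by (induction k') (simp_all add: add.assoc add.commute[of k])
    then show ?thesis by (simp add: 1(2) 2(2) D''_def E''_def)
  qed
  moreover have "\<forall>j<k + k'. D'' j \<in> Der I \<and> E'' j \<in> Der I"
    using 1(1) 2(1) by (auto simp: D''_def E''_def)
  ultimately show ?thesis
    unfolding Der2_def by (intro CollectI exI[of _ "k + k'"] exI[of _ D''] exI[of _ E'']) (simp add: fun_eq_iff)
qed

lemma Der2_sum:
  assumes "\<And>x. x \<in> A \<Longrightarrow> \<Psi> x \<in> Der2 I"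
  shows "(\<lambda>f g. \<Sum>x\<in>A. \<Psi> x f g) \<in> Der2 I"
  using assms
  by (induction A rule: infinite_finite_induct) (simp_all add: Der2_zero Der2_add)

lemma Der2_outside: "\<Psi> \<in> Der2 I \<Longrightarrow> f \<notin> chart I \<or> g \<notin> chart I \<Longrightarrow> \<Psi> f g = 0"
  by (auto simp: Der2_def Der_outside intro!: sum.neutral)

lemma Der2_in_chart:
  assumes "\<Psi> \<in> Der2 I"
  shows "\<Psi> f g \<in> chart I"
proof -
  obtain k D E where DE: "\<And>j. j < k \<Longrightarrow> D j \<in> Der I" "\<And>j. j < k \<Longrightarrow> E j \<in> Der I"
      and \<Psi>: "\<Psi> = (\<lambda>f g. \<Sum>j<(k::nat). D j f * E j g)"
    using assms unfolding Der2_def by blast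
  have "D j f * E j g \<in> chart I" if "j < k" for j
    by (intro chart_mult Der_in_chart[of "D j"] Der_in_chart[of "E j"] DE that)
  then show ?thesis
    unfolding \<Psi> by (intro chart_sum) simp
qed

lemma Der2_expand:
  assumes "\<Psi> \<in> Der2 I" "f \<in> chart I" "f' \<in> chart I"
  shows Der2_add_left: "\<Psi> (f + f') g = \<Psi> f g + \<Psi> f' g"
    and Der2_add_right: "\<Psi> g (f + f') = \<Psi> g f + \<Psi> g f'"
    and Der2_leibniz_left: "\<Psi> (f * f') g = \<Psi> f g * f' + f * \<Psi> f' g"
    and Der2_leibniz_right: "\<Psi> g (f * f') = \<Psi> g f * f' + f * \<Psi> g f'"
proof -
  obtain k D E where DE: "\<And>j. j < k \<Longrightarrow> D j \<in> Der I" "\<And>j. j < k \<Longrightarrow> E j \<in> Der I"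
      and \<Psi>: "\<Psi> = (\<lambda>f g. \<Sum>j<(k::nat). D j f * E j g)"
    using assms(1) unfolding Der2_def by blast
  note rules = Der_add[OF DE(1) assms(2,3)] Der_add[OF DE(2) assms(2,3)]
    Der_mult[OF DE(1) assms(2,3)] Der_mult[OF DE(2) assms(2,3)]
  show "\<Psi> (f + f') g = \<Psi> f g + \<Psi> f' g" "\<Psi> g (f + f') = \<Psi> g f + \<Psi> g f'"
      "\<Psi> (f * f') g = \<Psi> f g * f' + f * \<Psi> f' g" "\<Psi> g (f * f') = \<Psi> g f * f' + f * \<Psi> g f'"
    unfolding \<Psi> sum_distrib_left sum_distrib_right sum.distrib[symmetric]
    by (intro sum.cong refl; simp add: rules algebra_simps)+
qed

lemma Der2_const_mult:
  assumes "\<Psi> \<in> Der2 I" "f \<in> chart I"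
  shows Der2_const_mult_left: "\<Psi> (const c * f) g = const c * \<Psi> f g"
    and Der2_const_mult_right: "\<Psi> g (const c * f) = const c * \<Psi> g f"
proof -
  obtain k D E where DE: "\<And>j. j < k \<Longrightarrow> D j \<in> Der I" "\<And>j. j < k \<Longrightarrow> E j \<in> Der I"
      and \<Psi>: "\<Psi> = (\<lambda>f g. \<Sum>j<(k::nat). D j f * E j g)"
    using assms(1) unfolding Der2_def by blast
  note rules = Der_const_mult[OF DE(1) assms(2)] Der_const_mult[OF DE(2) assms(2)]
  show "\<Psi> (const c * f) g = const c * \<Psi> f g" "\<Psi> g (const c * f) = const c * \<Psi> g f"
    unfolding \<Psi> sum_distrib_left
    by (intro sum.cong refl; simp add: rules mult.assoc mult.left_commute)+
qed

section \<open>From a homogeneous field to a trilinear map\<close>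

lemma empty_in_fan: "{} \<in> fan"
  by (simp add: fan_def)

lemma other_index: obtains p :: 3 where "p \<noteq> l"
  by (rule that[of "if l = 0 then 1 else 0"]) simp

lemma singleton_in_fan: "{l} \<in> fan"
proof -
  obtain p where "p \<noteq> l" by (rule other_index)
  then show ?thesis by (auto simp: fan_def)
qed

lemma pre_higgs_Der2:
  assumes "pre_higgs \<Phi>" "I \<in> fan" "D \<in> Der I"
  shows "\<Phi> I D \<in> Der2 I"
  using bspec[OF bspec[OF assms(1)[unfolded pre_higgs_def, THEN conjunct1] assms(2)] assms(3)] .

lemma pre_higgs_add:
  assumes "pre_higgs \<Phi>" "I \<in> fan" "D \<in> Der I" "E \<in> Der I"
  shows "\<Phi> I (\<lambda>f. D f + E f) f g = \<Phi> I D f g + \<Phi> I E f g"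
  by (rule assms(1)[unfolded pre_higgs_def, THEN conjunct2, THEN conjunct1, THEN bspec, OF assms(2),
        THEN bspec, OF assms(3), THEN bspec, OF assms(4), THEN fun_cong, THEN fun_cong])

lemma pre_higgs_mult:
  assumes "pre_higgs \<Phi>" "I \<in> fan" "a \<in> chart I" "D \<in> Der I"
  shows "\<Phi> I (\<lambda>f. a * D f) f g = a * \<Phi> I D f g"
  by (rule assms(1)[unfolded pre_higgs_def, THEN conjunct2, THEN conjunct2, THEN conjunct1, THEN bspec,
        OF assms(2), THEN bspec, OF assms(3), THEN bspec, OF assms(4), THEN fun_cong, THEN fun_cong])

lemma pre_higgs_restrict:
  assumes "pre_higgs \<Phi>" "I \<in> fan" "J \<subseteq> I" "D \<in> Der I" "E \<in> Der J"
    and "\<And>f. f \<in> chart I \<Longrightarrow> E f = D f" and "f \<in> chart I" "g \<in> chart I"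
  shows "\<Phi> J E f g = \<Phi> I D f g"
  using assms(1)[unfolded pre_higgs_def, THEN conjunct2, THEN conjunct2, THEN conjunct2] assms(2-) by blast

text \<open>The map of fibres at 1 induced by \<open>\<Phi>\<close>, read off from the invariant vector fields.\<close>

definition torus_map :: "field \<Rightarrow> hom_N_NN" where
  "torus_map \<Phi> n = fibre2 (\<Phi> {} (der n))"

lemma is_fibre_der: "is_fibre (der n) n"
  by (simp add: is_fibre_def)

lemma associated_eq_torus_map:
  assumes "associated \<Phi> \<phi>"
  shows "\<phi> = torus_map \<Phi>"
proof
  fix n
  show "\<phi> n = torus_map \<Phi> n"
    using assms[unfolded associated_def, THEN bspec, OF der_in_Der, THEN spec, THEN mp, OF is_fibre_der]
    by (simp add: torus_map_def)
qed

lemma lookup_const_mult [simp]: "Poly_Mapping.lookup (const c * f) m = c * Poly_Mapping.lookup f m"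
  by (induction f rule: CM_induct) (simp_all add: mult_single lookup_single when_def distrib_left lookup_add)

lemma act_Der_der: "t \<in> torus \<Longrightarrow> act_Der t (der n) = der n"
  by (rule ext) (simp add: act_Der_def act_der act_inverse)

text \<open>The invariant fields are fixed by the torus, so homogeneity says that the image of
  \<open>(chi m, chi m')\<close> is an eigenvector with the character of \<open>r + m + m'\<close>. Characters separate degrees; hence it
  is a monomial, and its coefficient is its value at 1.\<close>

lemma homogeneous_on_monomials:
  assumes \<Phi>: "pre_higgs \<Phi>" and hom: "homogeneous r \<Phi>"
  shows "\<Phi> {} (der n) (chi m) (chi m') = Poly_Mapping.single (r + m + m') (torus_map \<Phi> n m m')"
proof -
  define \<Psi> where "\<Psi> = \<Phi> {} (der n)"
  have \<Psi>: "\<Psi> \<in> Der2 {}"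
    unfolding \<Psi>_def by (rule pre_higgs_Der2[OF \<Phi> empty_in_fan der_in_Der])
  have zero: "Poly_Mapping.lookup (\<Psi> (chi m) (chi m')) l = 0" if l: "l \<noteq> r + m + m'" for l
  proof -
    obtain t where t: "t \<in> torus" "character l t \<noteq> character (r + m + m') t"
      using characters_separate[OF l] by blast
    \<comment> \<open>Comparing coefficients at \<open>l\<close> in the homogeneity equation, applied to the translates of
      \<open>chi m\<close> and \<open>chi m'\<close>, leaves two different characters as factors.\<close>
    have act_chi: "act t (chi m) = const (character m t) * chi m" for m
      by (simp add: mult_single)
    note hom_der = bspec[OF bspec[OF bspec[OF hom[unfolded homogeneous_def] empty_in_fan] t(1)] der_in_Der[of n]]
    have eq: "act_Der2 t \<Psi> f g = const (character r t) * \<Psi> f g" for f g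
      by (simp only: hom_der act_Der_der[OF t(1)] \<Psi>_def)
    have "act t (\<Psi> (chi m) (chi m')) = act_Der2 t \<Psi> (act t (chi m)) (act t (chi m'))"
      by (simp only: act_Der2_def act_inverse'[OF t(1)])
    also have "\<dots> = const (character r t) * \<Psi> (const (character m t) * chi m) (const (character m' t) * chi m')"
      by (simp only: eq act_chi)
    also have "\<dots> = const (character r t) * (const (character m t) * (const (character m' t) * \<Psi> (chi m) (chi m')))"
      using Der2_const_mult_left[OF \<Psi>, of "chi m"] Der2_const_mult_right[OF \<Psi>, of "chi m'"]
      by (simp only: chart_empty UNIV_I simp_thms True_implies_equals mult.left_commute)
    also have "\<dots> = const (character (r + m + m') t) * \<Psi> (chi m) (chi m')"
      unfolding mult.assoc[symmetric] mult_single character_add[OF t(1)] add_0_left ..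
    finally have "Poly_Mapping.lookup (act t (\<Psi> (chi m) (chi m'))) l
        = Poly_Mapping.lookup (const (character (r + m + m') t) * \<Psi> (chi m) (chi m')) l"
      by (rule arg_cong)
    then have "character l t * Poly_Mapping.lookup (\<Psi> (chi m) (chi m')) l
        = character (r + m + m') t * Poly_Mapping.lookup (\<Psi> (chi m) (chi m')) l"
      by (simp only: act_eq_diag lookup_diag lookup_const_mult)
    then show ?thesis using t(2) by simp
  qed
  define c where "c = Poly_Mapping.lookup (\<Psi> (chi m) (chi m')) (r + m + m')"
  have "\<Psi> (chi m) (chi m') = Poly_Mapping.single (r + m + m') c"
    by (rule poly_mapping_eqI) (use zero c_def in \<open>auto simp: lookup_single when_def\<close>)
  then show ?thesis
    by (simp add: torus_map_def fibre2_def flip: \<Psi>_def)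
qed

lemma trilinear_torus_map:
  assumes \<Phi>: "pre_higgs \<Phi>"
  shows "trilinear (torus_map \<Phi>)"
proof -
  have D2: "\<Phi> {} (der n) \<in> Der2 {}" for n
    by (rule pre_higgs_Der2[OF \<Phi> empty_in_fan der_in_Der])
  have "der (n + n') = (\<lambda>f. der n f + der n' f)" for n n'
    by (rule ext) (rule der_add_left)
  then have 1: "\<Phi> {} (der (n + n')) f g = \<Phi> {} (der n) f g + \<Phi> {} (der n') f g" for n n' f g
    by (simp add: pre_higgs_add[OF \<Phi> empty_in_fan der_in_Der der_in_Der])
  have "der (scale_lat c n) = (\<lambda>f. const c * der n f)" for c n
    by (rule ext) (rule der_scale_left)
  then have 2: "\<Phi> {} (der (scale_lat c n)) f g = const c * \<Phi> {} (der n) f g" for c n f g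
    by (simp add: pre_higgs_mult[OF \<Phi> empty_in_fan _ der_in_Der])
  have chi: "chi (m1 + m2) = chi m1 * chi m2" for m1 m2
    by (simp add: mult_single)
  have 3: "value_at_1 (\<Psi> (chi (m1 + m2)) g) = value_at_1 (\<Psi> (chi m1) g) + value_at_1 (\<Psi> (chi m2) g)"
    and 4: "value_at_1 (\<Psi> g (chi (m1 + m2))) = value_at_1 (\<Psi> g (chi m1)) + value_at_1 (\<Psi> g (chi m2))"
    if "\<Psi> \<in> Der2 {}" for \<Psi> g m1 m2
    unfolding chi using Der2_leibniz_left[OF that] Der2_leibniz_right[OF that]
    by (simp_all add: value_at_1_add value_at_1_mult)
  show ?thesis
    unfolding trilinear_def torus_map_def fibre2_def
    by (simp add: 1 2 3[OF D2] 4[OF D2] value_at_1_add value_at_1_mult)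
qed

text \<open>Necessity of the pole condition. For \<open>n = \<rho>\<^sub>l\<close> the field \<open>\<chi>\<^sup>q \<partial>\<^sub>n\<close> with \<open>q\<^sub>l = -1\<close> is regular on the chart of
  \<open>{l}\<close>, so its image is regular as well; its value on two monomials of the chart is a monomial whose
  exponent must have nonnegative \<open>l\<close>-coordinate. This bounds \<open>r\<^sub>l + m\<^sub>l + m'\<^sub>l\<close>. Expanding \<open>m\<close> and \<open>m'\<close> in the basis
  \<open>ediff p\<close>, where only one basis vector has nonzero \<open>l\<close>-coordinate and that coordinate is 1,
  replaces \<open>m\<^sub>l\<close> by an indicator.\<close>

lemma pole_bound_torus_map:
  assumes \<Phi>: "pre_higgs \<Phi>" and hom: "homogeneous r \<Phi>"
  shows "pole_bound r (torus_map \<Phi>)"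
proof -
  note tri = trilinear_torus_map[OF \<Phi>]
  have weak: "of_bool (n = ray l) \<le> crd r l + crd m l + crd m' l"
    if p: "p \<noteq> l" and m: "0 \<le> crd m l" "0 \<le> crd m' l" and nz: "torus_map \<Phi> n m m' \<noteq> 0" for n m m' l p
  proof -
    define q where "q = (if n = ray l then - ediff p l else 0)"
    define D where "D = restr {l} (\<lambda>f. chi q * der n f)"
    have crd_q: "crd q l = - of_bool (n = ray l)"
      using p by (simp add: q_def)
    have D: "D \<in> Der {l}"
      unfolding D_def by (rule restr_monomial_der_in_Der) (simp add: crd_q)
    have "Poly_Mapping.single (q + (r + m + m')) (torus_map \<Phi> n m m') = chi q * \<Phi> {} (der n) (chi m) (chi m')"
      by (simp add: homogeneous_on_monomials[OF \<Phi> hom] mult_single)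
    also have "\<dots> = \<Phi> {} (\<lambda>f. chi q * der n f) (chi m) (chi m')"
      by (simp add: pre_higgs_mult[OF \<Phi> empty_in_fan _ der_in_Der])
    also have "\<dots> = \<Phi> {l} D (chi m) (chi m')"
      by (rule pre_higgs_restrict[OF \<Phi> singleton_in_fan _ D])
         (use m in \<open>auto simp: D_def restr_def der_in_Der Der_mult_left chart_single dual_cone_def\<close>)
    also have "\<dots> \<in> chart {l}"
      by (rule Der2_in_chart[OF pre_higgs_Der2[OF \<Phi> singleton_in_fan D]])
    finally have "q + (r + m + m') \<in> dual_cone {l}"
      using nz by (simp add: chart_iff_keys)
    then show ?thesis by (simp add: dual_cone_def crd_q)
  qed
  show ?thesis
    unfolding pole_bound_def
  proof (intro allI impI)
    fix l :: 3 and n m m'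
    assume nz: "torus_map \<Phi> n m m' \<noteq> 0"
    obtain p where p: "p \<noteq> l" by (rule other_index)
    \<comment> \<open>Some term in the expansion of \<open>m\<close>, and then of \<open>m'\<close>, has to be nonzero.\<close>
    obtain a where a: "crd m a \<noteq> 0" "torus_map \<Phi> n (ediff p a) m' \<noteq> 0"
      using nz unfolding trilinear_frame_left[OF tri, of n m m' p]
      by (metis (no_types, lifting) mult_zero_left mult_zero_right of_int_0 sum.neutral)
    obtain b where b: "crd m' b \<noteq> 0" "torus_map \<Phi> n (ediff p a) (ediff p b) \<noteq> 0"
      using a(2) unfolding trilinear_frame_right[OF tri, of n "ediff p a" m' p]
      by (metis (no_types, lifting) mult_zero_left mult_zero_right of_int_0 sum.neutral)
    have "of_bool (n = ray l) \<le> crd r l + crd (ediff p a) l + crd (ediff p b) l"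
      by (rule weak[OF p _ _ b(2)]) (use p in auto)
    then show "of_bool (n = ray l) \<le> crd r l + of_bool (crd m l \<noteq> 0) + of_bool (crd m' l \<noteq> 0)"
      using p a(1) b(1) by (auto simp: of_bool_def split: if_splits)
  qed
qed

text \<open>A section over any chart is a combination of invariant fields on the torus, so a field whose fibre map
  at 1 vanishes is zero on all charts.\<close>

lemma torus_map_nonzero:
  assumes \<Phi>: "pre_higgs \<Phi>" and hom: "homogeneous r \<Phi>" and nz: "nonzero_field \<Phi>"
  shows "\<exists>n m m'. torus_map \<Phi> n m m' \<noteq> 0"
proof (rule ccontr)
  assume "\<not> ?thesis"
  then have monomials: "\<Phi> {} (der n) (chi m) (chi m') = 0" for n m m'
    by (simp add: homogeneous_on_monomials[OF \<Phi> hom])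
  have D2: "\<Phi> {} (der n) \<in> Der2 {}" for n
    by (rule pre_higgs_Der2[OF \<Phi> empty_in_fan der_in_Der])
  have left: "\<Phi> {} (der n) f (chi m') = 0" for n f m'
  proof (induction f rule: CM_induct)
    case (single m c)
    show ?case
      using Der2_const_mult_left[OF D2, of "chi m" n c "chi m'"] by (simp add: monomials mult_single)
  next
    case (add f f')
    then show ?case using Der2_add_left[OF D2, of f f' n "chi m'"] by simp
  qed
  have torus: "\<Phi> {} (der n) f g = 0" for n f g
  proof (induction g rule: CM_induct)
    case (single m c)
    show ?case
      using Der2_const_mult_right[OF D2, of "chi m" n f c] by (simp add: left mult_single)
  next
    case (add g g')
    then show ?case using Der2_add_right[OF D2, of g g' n f] by simp
  qed
  obtain I D f g where I: "I \<in> fan" and D: "D \<in> Der I" and nz: "\<Phi> I D f g \<noteq> 0"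
    using nz unfolding nonzero_field_def by blast
  have fg: "f \<in> chart I" "g \<in> chart I"
    using nz Der2_outside[OF pre_higgs_Der2[OF \<Phi> I D]] by blast+
  obtain p where p: "p \<notin> I" using I by (auto simp: fan_def)
  define u where "u k = log_der D (ediff p k)" for k
  define E where "E = (\<lambda>f. (u 0 * der (ray 0) f + u 1 * der (ray 1) f) + u 2 * der (ray 2) f)"
  have term_in_Der: "(\<lambda>f. u k * der (ray k) f) \<in> Der {}" for k
    by (intro Der_mult_left der_in_Der) simp
  have zero: "\<Phi> {} (\<lambda>f. u k * der (ray k) f) f g = 0" for k f g
    by (simp add: pre_higgs_mult[OF \<Phi> empty_in_fan _ der_in_Der] torus)
  have sum_in_Der: "(\<lambda>f. D f + D' f) \<in> Der {}" if "D \<in> Der {}" "D' \<in> Der {}" for D D'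
    using that by (auto simp: Der_def algebra_simps)
  have "E \<in> Der {}"
    unfolding E_def by (intro sum_in_Der term_in_Der)
  then have "\<Phi> {} E f g = \<Phi> I D f g"
    by (intro pre_higgs_restrict[OF \<Phi> I _ D])
       (use fg in \<open>simp_all add: Der_frame[OF D p] sum_3' u_def E_def\<close>)
  moreover have "\<Phi> {} E f g = 0"
    unfolding E_def
    by (simp only: pre_higgs_add[OF \<Phi> empty_in_fan] sum_in_Der term_in_Der zero) simp
  ultimately show False using nz by simp
qed

section \<open>From a trilinear map to a homogeneous field\<close>

lemma single_sum: "Poly_Mapping.single k (\<Sum>x\<in>A. f x) = (\<Sum>x\<in>A. Poly_Mapping.single k (f x))"
  by (induction A rule: infinite_finite_induct) (simp_all add: single_add)

text \<open>The bilinear extension of \<open>(chi m, chi m') \<mapsto> \<beta> m m' \<cdot> chi (m + m')\<close> for a biadditive \<open>\<beta>\<close>, written as a combination of products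
  of invariant fields in the basis \<open>ediff p\<close>; this is the shape in which it can be recognized as an
  element of the tensor square on a chart.\<close>

definition frame_bider :: "3 \<Rightarrow> (M \<Rightarrow> M \<Rightarrow> complex) \<Rightarrow> CM \<Rightarrow> CM \<Rightarrow> CM" where
  "frame_bider p \<beta> f g =
    (\<Sum>a\<in>UNIV. \<Sum>b\<in>UNIV. const (\<beta> (ediff p a) (ediff p b)) * (der (ray a) f * der (ray b) g))"

lemma frame_bider_single:
  assumes "trilinear \<phi>"
  shows "frame_bider p (\<phi> n) (Poly_Mapping.single m c) (Poly_Mapping.single m' c')
    = Poly_Mapping.single (m + m') (\<phi> n m m' * (c * c'))"
proof -
  have "frame_bider p (\<phi> n) (Poly_Mapping.single m c) (Poly_Mapping.single m' c')
    = Poly_Mapping.single (m + m') (\<Sum>a\<in>UNIV. \<Sum>b\<in>UNIV. \<phi> n (ediff p a) (ediff p b)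
        * ((of_int (crd m a) * c) * (of_int (crd m' b) * c')))"
    by (simp only: frame_bider_def der_single pair_ray mult_single single_sum add_0_left)
  also have "(\<Sum>a\<in>UNIV. \<Sum>b\<in>UNIV. \<phi> n (ediff p a) (ediff p b)
        * ((of_int (crd m a) * c) * (of_int (crd m' b) * c')))
      = (\<Sum>a\<in>UNIV. of_int (crd m a) * (\<Sum>b\<in>UNIV. of_int (crd m' b) * \<phi> n (ediff p a) (ediff p b))) * (c * c')"
    unfolding sum_distrib_left sum_distrib_right by (intro sum.cong refl) (simp only: ac_simps)
  also have "\<dots> = \<phi> n m m' * (c * c')"
    by (simp only: trilinear_frame_left[OF assms, of n m m' p]
        trilinear_frame_right[OF assms, of n "ediff p _" m' p])
  finally show ?thesis .
qed

lemma frame_bider_add: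
  "frame_bider p \<beta> (f + f') g = frame_bider p \<beta> f g + frame_bider p \<beta> f' g"
  "frame_bider p \<beta> f (g + g') = frame_bider p \<beta> f g + frame_bider p \<beta> f g'"
  by (simp_all add: frame_bider_def der_add distrib_left distrib_right sum.distrib)

lemma frame_bider_independent:
  assumes "trilinear \<phi>"
  shows "frame_bider p (\<phi> n) f g = frame_bider q (\<phi> n) f g"
proof (induction f rule: CM_induct)
  case (single m c)
  show ?case
    by (induction g rule: CM_induct) (simp_all add: frame_bider_single[OF assms] frame_bider_add)
qed (simp add: frame_bider_add)

lemma frame_bider_sum_ray:
  assumes "trilinear \<phi>"
  shows "(\<Sum>k\<in>UNIV. frame_bider p (\<phi> (ray k)) f g) = 0"
proof -
  have "(\<Sum>k\<in>UNIV. frame_bider p (\<phi> (ray k)) f g) = frame_bider p (\<lambda>m m'. \<Sum>k\<in>UNIV. \<phi> (ray k) m m') f g"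
    by (simp add: frame_bider_def sum_3' single_add algebra_simps)
  then show ?thesis
    by (simp add: trilinear_sum_ray[OF assms] frame_bider_def)
qed

lemma act_frame_bider:
  assumes "t \<in> torus"
  shows "act t (frame_bider p \<beta> (act (torus_inv t) f) (act (torus_inv t) g)) = frame_bider p \<beta> f g"
  using assms by (simp add: frame_bider_def sum_3' act_add act_mult act_der act_inverse)

text \<open>The field \<open>\<phi> \<otimes> \<chi>\<^sup>r\<close>: in the notation of \<open>Der_frame\<close>, the invariant field of \<open>\<rho>\<^sub>k\<close> is replaced by
  the biderivation of \<open>\<phi> \<rho>\<^sub>k\<close>. The values of \<open>D\<close> enter linearly and are all taken on the chart itself, so
  linearity over the chart is immediate and no extension to the torus has to be chosen. The index \<open>p\<close> is an arbitrary choice for each chart.\<close>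

definition field_of :: "M \<Rightarrow> hom_N_NN \<Rightarrow> field" where
  "field_of r \<phi> I D = (\<lambda>f g. let p = (SOME p. p \<notin> I) in
     if f \<in> chart I \<and> g \<in> chart I
     then chi r * (\<Sum>k\<in>UNIV. log_der D (ediff p k) * frame_bider p (\<phi> (ray k)) f g) else 0)"

lemma field_of_outside: "\<not> (f \<in> chart I \<and> g \<in> chart I) \<Longrightarrow> field_of r \<phi> I D f g = 0"
  by (auto simp: field_of_def Let_def)

text \<open>Passing from one \<open>p\<close> to another adds the same logarithmic derivative to all three coefficients, which has no
  effect because the biderivations of \<open>\<phi> \<rho>\<^sub>0, \<phi> \<rho>\<^sub>1, \<phi> \<rho>\<^sub>2\<close> add up to zero.
  A cone and its faces can thus be compared with a common \<open>p\<close>, as compatibility with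
  restriction requires.\<close>

lemma field_of_frame:
  assumes \<phi>: "trilinear \<phi>" and D: "D \<in> Der I" and p: "p \<notin> I" and fg: "f \<in> chart I" "g \<in> chart I"
  shows "field_of r \<phi> I D f g
    = chi r * (\<Sum>k\<in>UNIV. log_der D (ediff p k) * frame_bider p (\<phi> (ray k)) f g)"
proof -
  define q where "q = (SOME p. p \<notin> I)"
  have q: "q \<notin> I" unfolding q_def by (rule someI) (rule p)
  have change: "log_der D (ediff q k) = log_der D (ediff q p) + log_der D (ediff p k)" for k
    unfolding log_der_add[OF D ediff_in_dual_cone[OF q] ediff_in_dual_cone[OF p], symmetric]
    by (rule arg_cong[OF ediff_change])
  have "(\<Sum>k\<in>UNIV. log_der D (ediff q k) * frame_bider p (\<phi> (ray k)) f g)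
      = log_der D (ediff q p) * (\<Sum>k\<in>UNIV. frame_bider p (\<phi> (ray k)) f g)
        + (\<Sum>k\<in>UNIV. log_der D (ediff p k) * frame_bider p (\<phi> (ray k)) f g)"
    unfolding sum_distrib_left sum.distrib[symmetric] distrib_right[symmetric]
    by (intro sum.cong refl arg_cong2[where f = "(*)"] change)
  then show ?thesis
    using fg by (simp add: field_of_def frame_bider_sum_ray[OF \<phi>]
        frame_bider_independent[OF \<phi>, of q _ _ _ p] flip: q_def)
qed

text \<open>Sufficiency of the pole condition. Let \<open>x\<^sub>k\<close> be the monomial of \<open>ediff p k\<close>. Dividing the invariant field of \<open>\<rho>\<^sub>a\<close> by \<open>x\<^sub>a\<close> gives
  the regular fields \<open>R a\<close> of the chart. In terms of these the coefficient of \<open>R a \<otimes> R b\<close> is a sum of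
  \<open>D x\<^sub>k\<close> times a monomial of exponent \<open>r - ediff p k + ediff p a + ediff p b\<close>; whenever the
  corresponding coefficient of \<open>\<phi>\<close> is nonzero, the pole condition at \<open>n = \<rho>\<^sub>k\<close> says precisely that
  this exponent lies in the dual cone.\<close>

lemma field_of_in_Der2:
  assumes \<phi>: "trilinear \<phi>" and pole: "pole_bound r \<phi>" and I: "I \<in> fan" and D: "D \<in> Der I"
  shows "field_of r \<phi> I D \<in> Der2 I"
proof -
  obtain p where p: "p \<notin> I" using I by (auto simp: fan_def)
  define R where "R a = restr I (\<lambda>f. chi (- ediff p a) * der (ray a) f)" for a
  define U where "U k a b = Poly_Mapping.single (r - ediff p k + ediff p a + ediff p b)
      (\<phi> (ray k) (ediff p a) (ediff p b)) * D (chi (ediff p k))" for k a b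
  have R: "R a \<in> Der I" for a
    unfolding R_def by (rule restr_monomial_der_in_Der) (use p in auto)
  have U: "U k a b \<in> chart I" for k a b
  proof (cases "\<phi> (ray k) (ediff p a) (ediff p b) = 0")
    case False
    have "r - ediff p k + ediff p a + ediff p b \<in> dual_cone I"
      unfolding dual_cone_def
    proof (rule CollectI, rule ballI)
      fix l assume l: "l \<in> I"
      then have "l \<noteq> p" using p by blast
      then show "0 \<le> crd (r - ediff p k + ediff p a + ediff p b) l"
        using pole[unfolded pole_bound_def, rule_format, OF False, of l]
        by (auto simp: of_bool_def split: if_splits)
    qed
    then show ?thesis
      unfolding U_def by (intro chart_mult chart_single Der_in_chart[OF D])
  qed (simp add: U_def)
  have "field_of r \<phi> I D f g = (\<Sum>k\<in>UNIV. \<Sum>a\<in>UNIV. \<Sum>b\<in>UNIV. (U k a b * R a f) * R b g)" for f g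
  proof (cases "f \<in> chart I \<and> g \<in> chart I")
    case True
    have eq: "chi r * (log_der D (ediff p k) * (const (\<phi> (ray k) (ediff p a) (ediff p b)) * (F * G)))
        = (U k a b * (chi (- ediff p a) * F)) * (chi (- ediff p b) * G)" for k a b F G
    proof -
      have "Poly_Mapping.single (r - ediff p k + ediff p a + ediff p b) (\<phi> (ray k) (ediff p a) (ediff p b))
          = const (\<phi> (ray k) (ediff p a) (ediff p b)) * chi r * chi (- ediff p k) * chi (ediff p a) * chi (ediff p b)"
        by (simp add: mult_single)
      then have "(U k a b * (chi (- ediff p a) * F)) * (chi (- ediff p b) * G)
          = (chi (- ediff p a) * chi (ediff p a)) * (chi (- ediff p b) * chi (ediff p b))
            * (chi r * (chi (- ediff p k) * D (chi (ediff p k)) * (const (\<phi> (ray k) (ediff p a) (ediff p b)) * (F * G))))"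
        unfolding U_def by (simp only: ac_simps)
      then show ?thesis
        by (simp only: chi_cancel log_der_def mult_1_left)
    qed
    show ?thesis
      using True
      by (simp only: field_of_frame[OF \<phi> D p] frame_bider_def sum_distrib_left eq R_def restr_def if_True)
  next
    case False
    then show ?thesis
      by (auto simp: field_of_outside Der_outside[OF R])
  qed
  then have "field_of r \<phi> I D = (\<lambda>f g. \<Sum>k\<in>UNIV. \<Sum>a\<in>UNIV. \<Sum>b\<in>UNIV. (U k a b * R a f) * R b g)"
    by (intro ext)
  moreover have "(\<lambda>f g. (U k a b * R a f) * R b g) \<in> Der2 I" for k a b
    by (rule Der2_mult[of "\<lambda>f. U k a b * R a f"]) (intro Der_mult_left U R)+
  ultimately show ?thesis
    by (simp add: Der2_sum)
qed

lemma pre_higgs_field_of: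
  assumes \<phi>: "trilinear \<phi>" and pole: "pole_bound r \<phi>"
  shows "pre_higgs (field_of r \<phi>)"
proof -
  have add: "field_of r \<phi> I (\<lambda>f. D f + E f) = (\<lambda>f g. field_of r \<phi> I D f g + field_of r \<phi> I E f g)" for I D E
    by (intro ext) (simp add: field_of_def Let_def log_der_def distrib_left distrib_right sum.distrib)
  have mult: "field_of r \<phi> I (\<lambda>f. a * D f) = (\<lambda>f g. a * field_of r \<phi> I D f g)" for I D a
  proof (intro ext)
    fix f g
    have "log_der (\<lambda>f. a * D f) m = a * log_der D m" for m
      by (simp add: log_der_def mult.left_commute)
    then show "field_of r \<phi> I (\<lambda>f. a * D f) f g = a * field_of r \<phi> I D f g"
      by (simp add: field_of_def Let_def mult.assoc mult.left_commute[of "chi r"] flip: sum_distrib_left)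
  qed
  have restrict: "field_of r \<phi> J E f g = field_of r \<phi> I D f g"
    if I: "I \<in> fan" and J: "J \<subseteq> I" and DE: "D \<in> Der I" "E \<in> Der J"
      and agree: "\<forall>f\<in>chart I. E f = D f" and fg: "f \<in> chart I" "g \<in> chart I" for I J D E f g
  proof -
    obtain p where p: "p \<notin> I" using I by (auto simp: fan_def)
    then have p': "p \<notin> J" using J by blast
    have fg': "f \<in> chart J" "g \<in> chart J" using fg chart_mono[OF J] by auto
    have "E (chi (ediff p k)) = D (chi (ediff p k))" for k
      using agree chart_single[OF ediff_in_dual_cone[OF p]] by blast
    then show ?thesis
      by (simp only: field_of_frame[OF \<phi> DE(1) p fg] field_of_frame[OF \<phi> DE(2) p' fg'] log_der_def)
  qed
  show ?thesis
    unfolding pre_higgs_def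
    by (intro conjI ballI allI impI) (rule field_of_in_Der2[OF \<phi> pole] add mult restrict; assumption)+
qed

lemma character_uminus:
  assumes "t \<in> torus"
  shows "character (- m) t = inverse (character m t)"
proof -
  have "character m t * character (- m) t = 1"
    by (simp flip: character_add[OF assms])
  then show ?thesis by (simp add: inverse_unique)
qed

lemma log_der_act:
  assumes t: "t \<in> torus" and D: "D \<in> Der I" and m: "m \<in> dual_cone I"
  shows "log_der (act_Der t D) m = act t (log_der D m)"
proof -
  have "act_Der t D (chi m) = const (inverse (character m t)) * act t (D (chi m))"
    unfolding act_Der_def act_single character_torus_inv mult_1_right
      Der_single[OF D m, of "inverse (character m t)"] act_mult[OF t]
    by simp
  moreover have "act t (chi (- m)) = chi (- m) * const (inverse (character m t))"
    by (simp add: character_uminus[OF t] mult_single)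
  ultimately show ?thesis
    by (simp only: log_der_def act_mult[OF t] mult.assoc)
qed

lemma homogeneous_field_of:
  assumes "trilinear \<phi>"
  shows "homogeneous r (field_of r \<phi>)"
  unfolding homogeneous_def
proof (intro ballI ext)
  fix I t D f g
  assume I: "I \<in> fan" and t: "t \<in> torus" and D: "D \<in> Der I"
  define p where "p = (SOME p. p \<notin> I)"
  have p: "p \<notin> I"
    unfolding p_def by (rule someI_ex) (use I in \<open>auto simp: fan_def\<close>)
  have chart_act_iff: "act (torus_inv t) f \<in> chart I \<longleftrightarrow> f \<in> chart I" for f
    using chart_act[of "act (torus_inv t) f" I t] chart_act[of f I] act_inverse[OF t, of f] by auto
  have chi_r: "act t (chi r) = const (character r t) * chi r"
    by (simp add: mult_single)
  have act_sum: "act t (\<Sum>k\<in>A. h k) = (\<Sum>k\<in>A. act t (h k))" for A :: "3 set" and h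
    by (induction A rule: infinite_finite_induct) (simp_all add: act_add, simp_all add: act_eq_diag)
  show "act_Der2 t (field_of r \<phi> I D) f g = const (character r t) * field_of r \<phi> I (act_Der t D) f g"
  proof (cases "f \<in> chart I \<and> g \<in> chart I")
    case True
    then show ?thesis
      by (simp only: act_Der2_def field_of_def Let_def p_def[symmetric] chart_act_iff if_True simp_thms
          act_mult[OF t] act_sum act_frame_bider[OF t] chi_r log_der_act[OF t D ediff_in_dual_cone[OF p]] mult.assoc)
  next
    case False
    then show ?thesis
      by (simp add: act_Der2_def field_of_outside chart_act_iff) (simp add: act_eq_diag)
  qed
qed

text \<open>At the point 1 all monomials take the value 1, and what remains of \<open>field_of\<close> is the expansion of
  \<open>\<phi> n\<close> in the basis of rays.\<close>

lemma associated_field_of: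
  assumes \<phi>: "trilinear \<phi>"
  shows "associated (field_of r \<phi>) \<phi>"
  unfolding associated_def
proof (intro ballI allI impI ext)
  fix D n m m'
  assume D: "D \<in> Der {}" and n: "is_fibre D n"
  have "fibre2 (field_of r \<phi> {} D) m m'
      = value_at_1 (chi r * (\<Sum>k\<in>UNIV. log_der D (ediff 0 k) * frame_bider 0 (\<phi> (ray k)) (chi m) (chi m')))"
    unfolding fibre2_def by (subst field_of_frame[OF \<phi> D, of 0]) simp_all
  also have "\<dots> = (\<Sum>k\<in>UNIV. pair (ediff 0 k) n * \<phi> (ray k) m m')"
    using n by (simp add: value_at_1_mult value_at_1_sum log_der_def frame_bider_single[OF \<phi>] is_fibre_def)
  also have "\<dots> = \<phi> n m m'"
    by (rule trilinear_frame_N[OF \<phi>, symmetric])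
  finally show "\<phi> n m m' = fibre2 (field_of r \<phi> {} D) m m'" by simp
qed

lemma V_eq: "V r = {\<phi>. trilinear \<phi> \<and> pole_bound r \<phi>}"
proof (intro equalityI subsetI CollectI)
  fix \<phi> assume "\<phi> \<in> V r"
  then obtain \<Phi> where "pre_higgs \<Phi>" "homogeneous r \<Phi>" "\<phi> = torus_map \<Phi>"
    unfolding V_def using associated_eq_torus_map by blast
  then show "trilinear \<phi> \<and> pole_bound r \<phi>"
    by (simp add: trilinear_torus_map pole_bound_torus_map)
next
  fix \<phi> assume "\<phi> \<in> {\<phi>. trilinear \<phi> \<and> pole_bound r \<phi>}"
  then show "\<phi> \<in> V r"
    unfolding V_def using pre_higgs_field_of homogeneous_field_of associated_field_of by blast
qed

lemma admissible_iff:
  "admissible r \<longleftrightarrow> (\<exists>\<phi> n m m'. trilinear \<phi> \<and> pole_bound r \<phi> \<and> \<phi> n m m' \<noteq> 0)"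
proof
  assume "admissible r"
  then obtain \<Phi> where \<Phi>: "pre_higgs \<Phi>" "homogeneous r \<Phi>" "nonzero_field \<Phi>"
    unfolding admissible_def by blast
  then show "\<exists>\<phi> n m m'. trilinear \<phi> \<and> pole_bound r \<phi> \<and> \<phi> n m m' \<noteq> 0"
    using trilinear_torus_map pole_bound_torus_map torus_map_nonzero by blast
next
  assume "\<exists>\<phi> n m m'. trilinear \<phi> \<and> pole_bound r \<phi> \<and> \<phi> n m m' \<noteq> 0"
  then obtain \<phi> n m m' where \<phi>: "trilinear \<phi>" "pole_bound r \<phi>" and nz: "\<phi> n m m' \<noteq> 0"
    by blast
  have "\<phi> n = fibre2 (field_of r \<phi> {} (der n))"
    using associated_field_of[OF \<phi>(1), unfolded associated_def, THEN bspec, OF der_in_Der, THEN spec,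
        THEN mp, OF is_fibre_der] .
  then have "\<phi> n m m' = value_at_1 (field_of r \<phi> {} (der n) (chi m) (chi m'))"
    by (simp add: fibre2_def)
  then have "field_of r \<phi> {} (der n) (chi m) (chi m') \<noteq> 0"
    using nz by (metis value_at_1_zero)
  then have "nonzero_field (field_of r \<phi>)"
    unfolding nonzero_field_def using empty_in_fan der_in_Der by blast
  then show "admissible r"
    unfolding admissible_def using pre_higgs_field_of[OF \<phi>] homogeneous_field_of[OF \<phi>(1)] by blast
qed

section \<open>Dimensions of the trace-free spaces\<close>

lemma triple_exhaust:
  assumes "i \<noteq> j" "i \<noteq> k" "j \<noteq> (k :: 3)"
  shows "(UNIV :: 3 set) = {i, j, k}"
proof (rule sym, rule card_subset_eq)
  show "card {i, j, k} = card (UNIV :: 3 set)"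
    using assms by simp
qed auto

lemma sum_triple:
  fixes f :: "3 \<Rightarrow> 'a::comm_monoid_add"
  assumes "i \<noteq> j" "i \<noteq> k" "j \<noteq> k"
  shows "(\<Sum>x\<in>UNIV. f x) = f i + f j + f k"
  unfolding triple_exhaust[OF assms] using assms by (simp add: add.assoc)

lemma complete_triple:
  obtains j k :: 3 where "i \<noteq> j" "i \<noteq> k" "j \<noteq> k"
proof -
  have "\<forall>i. \<exists>j k :: 3. i \<noteq> j \<and> i \<noteq> k \<and> j \<noteq> k"
    unfolding forall_3'
  proof (intro conjI)
    show "\<exists>j k :: 3. 0 \<noteq> j \<and> 0 \<noteq> k \<and> j \<noteq> k" by (rule exI[of _ 1], rule exI[of _ 2]) simp
    show "\<exists>j k :: 3. 1 \<noteq> j \<and> 1 \<noteq> k \<and> j \<noteq> k" by (rule exI[of _ 0], rule exI[of _ 2]) simp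
    show "\<exists>j k :: 3. 2 \<noteq> j \<and> 2 \<noteq> k \<and> j \<noteq> k" by (rule exI[of _ 0], rule exI[of _ 1]) simp
  qed
  then show ?thesis using that by blast
qed

lemma trilinear_expand:
  assumes "trilinear \<phi>" and ijk: "i \<noteq> j" "i \<noteq> k" "j \<noteq> k"
  shows "\<phi> n m m' =
      pair (ediff k i) n *
        (of_int (crd m i) * of_int (crd m' i) * \<phi> (ray i) (ediff k i) (ediff k i)
        + of_int (crd m i) * of_int (crd m' j) * \<phi> (ray i) (ediff k i) (ediff k j)
        + of_int (crd m j) * of_int (crd m' i) * \<phi> (ray i) (ediff k j) (ediff k i)
        + of_int (crd m j) * of_int (crd m' j) * \<phi> (ray i) (ediff k j) (ediff k j))
    + pair (ediff k j) n *
        (of_int (crd m i) * of_int (crd m' i) * \<phi> (ray j) (ediff k i) (ediff k i)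
        + of_int (crd m i) * of_int (crd m' j) * \<phi> (ray j) (ediff k i) (ediff k j)
        + of_int (crd m j) * of_int (crd m' i) * \<phi> (ray j) (ediff k j) (ediff k i)
        + of_int (crd m j) * of_int (crd m' j) * \<phi> (ray j) (ediff k j) (ediff k j))"
  by (subst trilinear_frame[OF assms(1), of _ _ _ k])
     (simp add: sum_triple[OF ijk] trilinear_zero[OF assms(1)] algebra_simps)

text \<open>Some coefficient of \<open>\<phi>\<close> in the basis \<open>ediff p\<close> is nonzero. Its three indices differ from \<open>p\<close>, so in the sum of
  the pole conditions at the two rays other than \<open>\<rho>\<^sub>p\<close> each of the three indicators contributes exactly
  once: \<open>1 \<le> - r\<^sub>p + 1 + 1\<close>.\<close>

lemma admissible_degree_le:
  assumes \<phi>: "trilinear \<phi>" and pole: "pole_bound r \<phi>" and nz: "\<phi> n m m' \<noteq> 0"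
  shows "crd r p \<le> 1"
proof -
  obtain i j where ij: "p \<noteq> i" "p \<noteq> j" "i \<noteq> j" by (rule complete_triple)
  have "\<exists>k\<in>{i, j}. \<exists>a\<in>{i, j}. \<exists>b\<in>{i, j}. \<phi> (ray k) (ediff p a) (ediff p b) \<noteq> 0"
  proof (rule ccontr)
    assume "\<not> ?thesis"
    then have "\<phi> n m m' = 0"
      by (subst trilinear_expand[OF \<phi> ij(3) ij(1,2)[symmetric]]) simp
    then show False using nz by simp
  qed
  then obtain k a b where nz': "\<phi> (ray k) (ediff p a) (ediff p b) \<noteq> 0" and k: "k \<in> {i, j}"
    and a: "a \<in> {i, j}" and b: "b \<in> {i, j}"
    by blast
  have "of_bool (k = l) \<le> crd r l + of_bool (a = l) + of_bool (b = l)" if "l \<noteq> p" for l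
    using pole[unfolded pole_bound_def, rule_format, OF nz', of l] that
    by (auto simp: of_bool_def split: if_splits)
  from this[of i] this[of j] show ?thesis
    using k a b ij sum_crd[of r] unfolding sum_triple[OF ij]
    by (auto simp: of_bool_def split: if_splits)
qed

lemma pair_contract:
  assumes \<phi>: "trilinear \<phi>"
  shows "pair m (contract \<phi> s n) = \<phi> n m s"
proof -
  define k where "k = (\<Sum>a\<in>UNIV. scale_lat (\<phi> n (ediff 0 a) s) (ray a))"
  have k: "pair m k = \<phi> n m s" for m
    unfolding trilinear_frame_left[OF \<phi>, of n m s 0]
    by (simp add: k_def sum_3' pair_add pair_scale pair_ray mult.commute)
  have "contract \<phi> s n = k"
    unfolding contract_def
  proof (rule the_equality)
    show "k' = k" if "\<forall>m. pair m k' = \<phi> n m s" for k'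
      by (rule pair_eqI) (simp add: k that)
  qed (simp add: k)
  then show ?thesis using k by simp
qed

text \<open>The trace is computed in the basis \<open>\<rho>\<^sub>1, \<rho>\<^sub>2\<close> by definition; as the values of \<open>\<phi>\<close> on the three rays add up to zero,
  every other \<open>p\<close> gives the same sum.\<close>

lemma trace_contract:
  assumes \<phi>: "trilinear \<phi>"
  shows "trace_N (contract \<phi> s) = (\<Sum>k\<in>UNIV. \<phi> (ray k) (ediff p k) s)"
proof -
  have mpt_ediff: "mpt (- 1) 1 0 = ediff 0 1" "mpt (- 1) 0 1 = ediff 0 2"
    by (rule M_eqI; simp add: vec_of_mpt of_bool_def; metis UNIV_3' UNIV_I insertE singletonD)+
  have "NC.representation {ray 1, ray 2} v
      = (\<lambda>b. pair (ediff 0 1) v * of_bool (b = ray 1) + pair (ediff 0 2) v * of_bool (b = ray 2))" for v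
    by (subst lat_decompose[of v])
       (auto simp: mpt_ediff NC.representation_add NC.representation_scale NC.representation_basis
          NC_basis NC.span_base fun_eq_iff of_bool_def)
  then have "trace_N (contract \<phi> s) = \<phi> (ray 1) (ediff 0 1) s + \<phi> (ray 2) (ediff 0 2) s"
    using NC_basis(1) by (simp add: trace_N_def pair_contract[OF \<phi>])
  also have "\<dots> = (\<Sum>k\<in>UNIV. \<phi> (ray k) (ediff 0 k) s)"
    by (simp add: sum_3' trilinear_zero[OF \<phi>])
  also have "\<dots> = (\<Sum>k\<in>UNIV. \<phi> (ray k) (ediff 0 p) s + \<phi> (ray k) (ediff p k) s)"
    by (intro sum.cong refl, subst ediff_change[of 0 _ p]) (use \<phi> in \<open>simp add: trilinear_def\<close>)
  also have "\<dots> = (\<Sum>k\<in>UNIV. \<phi> (ray k) (ediff p k) s)"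
    by (simp add: sum.distrib trilinear_sum_ray[OF \<phi>])
  finally show ?thesis .
qed

lemma V0_eq:
  "V0 r = {\<phi>. trilinear \<phi> \<and> pole_bound r \<phi> \<and> (\<forall>s. (\<Sum>k\<in>UNIV. \<phi> (ray k) (ediff p k) s) = 0)}"
  unfolding V0_def V_eq using trace_contract[of _ _ p] by auto

text \<open>If \<open>r\<^sub>i \<le> -2\<close>, the pole condition needs both indicators at \<open>\<rho>\<^sub>i\<close>, and the one of \<open>s\<close> is 0.\<close>

lemma contract_zero:
  assumes "\<phi> \<in> V r" and r: "crd r i \<le> - 2" and s: "crd s i = 0"
  shows "contract \<phi> s = (\<lambda>n. 0)"
proof
  fix n
  have \<phi>: "trilinear \<phi>" "pole_bound r \<phi>" using assms(1) by (simp_all add: V_eq)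
  show "contract \<phi> s n = 0"
  proof (rule pair_eqI)
    fix m
    have "\<phi> n m s = 0"
    proof (rule ccontr)
      assume "\<phi> n m s \<noteq> 0"
      then show False
        using \<phi>(2)[unfolded pole_bound_def, rule_format, of n m s i] r s
        by (auto simp: of_bool_def split: if_splits)
    qed
    then show "pair m (contract \<phi> s n) = pair m 0"
      by (simp add: pair_contract[OF \<phi>(1)] pair_zero)
  qed
qed

lemma sum_hom_apply: "(\<Sum>x\<in>A. F x) n m m' = (\<Sum>x\<in>A. (F x :: hom_N_NN) n m m')"
  by (induction A rule: infinite_finite_induct) simp_all

text \<open>Dimension of a space of trilinear maps from a family \<open>B\<close> that is dual to evaluations at chosen
  triples, with respect to which every element is expanded.\<close>

lemma dim_eq_card_evaluations:
  fixes B :: "'i \<Rightarrow> hom_N_NN"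
  assumes fin: "finite X" and B: "\<And>x. x \<in> X \<Longrightarrow> B x \<in> S"
    and dual: "\<And>x y. x \<in> X \<Longrightarrow> y \<in> X \<Longrightarrow> B x (n y) (m y) (m' y) = of_bool (x = y)"
    and expand: "\<And>\<phi>. \<phi> \<in> S \<Longrightarrow> \<phi> = (\<Sum>x\<in>X. scale_hom (\<phi> (n x) (m x) (m' x)) (B x))"
  shows "Hom_N.dim S = card X"
proof (rule Hom_N.dim_unique)
  have inj: "inj_on B X"
  proof (rule inj_onI)
    fix x y assume "x \<in> X" "y \<in> X" "B x = B y"
    then show "x = y" using dual[of x y] dual[of y y] by (simp split: if_splits)
  qed
  show "B ` X \<subseteq> S" using B by blast
  show "card (B ` X) = card X" by (rule card_image[OF inj])
  show "S \<subseteq> Hom_N.span (B ` X)"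
  proof
    fix \<phi> assume "\<phi> \<in> S"
    have "(\<Sum>x\<in>X. scale_hom (\<phi> (n x) (m x) (m' x)) (B x)) \<in> Hom_N.span (B ` X)"
      by (intro Hom_N.span_sum Hom_N.span_scale Hom_N.span_base) simp
    then show "\<phi> \<in> Hom_N.span (B ` X)" using expand[OF \<open>\<phi> \<in> S\<close>] by simp
  qed
  show "Hom_N.independent (B ` X)"
  proof (rule Hom_N.independent_if_scalars_zero)
    show "finite (B ` X)" using fin by simp
    fix f b assume zero: "(\<Sum>b\<in>B ` X. scale_hom (f b) b) = 0" and "b \<in> B ` X"
    then obtain y where y: "y \<in> X" "b = B y" by blast
    have "0 = (\<Sum>x\<in>X. scale_hom (f (B x)) (B x)) (n y) (m y) (m' y)"
      using zero by (simp add: sum.reindex[OF inj])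
    also have "\<dots> = (\<Sum>x\<in>X. if x = y then f (B x) else 0)"
      unfolding sum_hom_apply by (rule sum.cong) (simp_all add: scale_hom_def dual y(1))
    finally show "f b = 0" using fin y by simp
  qed
qed

text \<open>The condition at \<open>\<rho>\<^sub>i\<close> kills \<open>\<phi> \<rho>\<^sub>i\<close> and every coefficient involving \<open>ediff k j\<close>; what is left is a
  multiple of \<open>n \<mapsto> \<langle>ediff k j, n\<rangle> \<rho>\<^sub>i \<otimes> \<rho>\<^sub>i\<close>, whose contractions have zero trace because
  \<open>\<rho>\<^sub>i\<close> spans the kernel of \<open>ediff k j\<close>.\<close>

lemma dim_V0_vertex:
  assumes ijk: "i \<noteq> j" "i \<noteq> k" "j \<noteq> k" and r: "crd r i = - 2" "crd r j = 1" "crd r k = 1"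
  shows "Hom_N.dim (V0 r) = 1"
proof -
  define B :: hom_N_NN where
    "B n m m' = pair (ediff k j) n * of_int (crd m i) * of_int (crd m' i)" for n m m'
  have all: "l = i \<or> l = j \<or> l = k" for l
    using triple_exhaust[OF ijk] by blast
  have "Hom_N.dim (V0 r) = card {()}"
  proof (rule dim_eq_card_evaluations[where B = "\<lambda>_. B" and n = "\<lambda>_. ray j"
        and m = "\<lambda>_. ediff k i" and m' = "\<lambda>_. ediff k i"])
    have "trilinear B"
      by (simp add: trilinear_def B_def pair_add pair_scale algebra_simps)
    moreover have "pole_bound r B"
      unfolding pole_bound_def
    proof (intro allI impI)
      fix l n m m' assume "B n m m' \<noteq> 0"
      then show "of_bool (n = ray l) \<le> crd r l + of_bool (crd m l \<noteq> 0) + of_bool (crd m' l \<noteq> 0)"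
        using all[of l] ijk r by (auto simp: B_def)
    qed
    moreover have "(\<Sum>x\<in>UNIV. B (ray x) (ediff k x) s) = 0" for s
      using ijk by (simp add: sum_triple[OF ijk] B_def)
    ultimately show "B \<in> V0 r" by (simp add: V0_eq[of r k])
    show "B (ray j) (ediff k i) (ediff k i) = of_bool (x = y)" for x y :: unit
      using ijk by (simp add: B_def)
    fix \<phi> assume "\<phi> \<in> V0 r"
    then have \<phi>: "trilinear \<phi>" "pole_bound r \<phi>" by (simp_all add: V0_eq[of r k])
    have bound: "n \<noteq> ray i \<and> crd m i \<noteq> 0 \<and> crd m' i \<noteq> 0" if "\<phi> n m m' \<noteq> 0" for n m m'
      using \<phi>(2)[unfolded pole_bound_def, rule_format, OF that, of i] r
      by (auto simp: of_bool_def split: if_splits)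
    have "\<phi> (ray i) m m' = 0" for m m'
      using bound by blast
    moreover have "\<phi> n (ediff k j) m' = 0" "\<phi> n m (ediff k j) = 0" for n m m'
      using bound[of n "ediff k j" m'] bound[of n m "ediff k j"] ijk by auto
    ultimately show "\<phi> = (\<Sum>x\<in>{()}. scale_hom (\<phi> (ray j) (ediff k i) (ediff k i)) B)"
      by (intro ext, subst trilinear_expand[OF \<phi>(1) ijk]) (simp add: B_def scale_hom_def)
  qed simp
  then show ?thesis by simp
qed

text \<open>In the basis \<open>\<rho>\<^sub>i, \<rho>\<^sub>j\<close> the conditions at \<open>\<rho>\<^sub>i\<close> and \<open>\<rho>\<^sub>j\<close> leave \<open>\<phi> \<rho>\<^sub>i = a \<rho>\<^sub>i \<otimes> \<rho>\<^sub>i\<close> and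
  \<open>\<phi> \<rho>\<^sub>j = b \<rho>\<^sub>i \<otimes> \<rho>\<^sub>j + c \<rho>\<^sub>j \<otimes> \<rho>\<^sub>i\<close>. The contraction with \<open>s\<close> has trace \<open>(a + c) s\<^sub>i\<close>, hence \<open>c = - a\<close>, and
  \<open>B1\<close>, \<open>B2\<close> are the solutions with \<open>(a, b) = (1, 0)\<close> and \<open>(0, 1)\<close>.\<close>

lemma dim_V0_edge:
  assumes ijk: "i \<noteq> j" "i \<noteq> k" "j \<noteq> k" and r: "crd r i = - 1" "crd r j = 0" "crd r k = 1"
  shows "Hom_N.dim (V0 r) = 2"
proof -
  define B1 :: hom_N_NN where
    "B1 n m m' = pair (ediff k i) n * of_int (crd m i) * of_int (crd m' i)
      - pair (ediff k j) n * of_int (crd m j) * of_int (crd m' i)" for n m m'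
  define B2 :: hom_N_NN where
    "B2 n m m' = pair (ediff k j) n * of_int (crd m i) * of_int (crd m' j)" for n m m'
  note B_defs = B1_def B2_def
  have all: "l = i \<or> l = j \<or> l = k" for l
    using triple_exhaust[OF ijk] by blast
  have "Hom_N.dim (V0 r) = card (UNIV :: bool set)"
  proof (rule dim_eq_card_evaluations[where B = "\<lambda>x. if x then B1 else B2"
        and n = "\<lambda>x. if x then ray i else ray j"
        and m = "\<lambda>x. ediff k i" and m' = "\<lambda>x. if x then ediff k i else ediff k j"])
    have "trilinear B1" "trilinear B2"
      by (simp_all add: trilinear_def B_defs pair_add pair_scale algebra_simps)
    moreover have "pole_bound r B1"
      unfolding pole_bound_def
    proof (intro allI impI)
      fix l n m m' assume "B1 n m m' \<noteq> 0"
      then show "of_bool (n = ray l) \<le> crd r l + of_bool (crd m l \<noteq> 0) + of_bool (crd m' l \<noteq> 0)"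
        using all[of l] ijk r by (cases "n = ray l") (auto simp: B1_def)
    qed
    moreover have "pole_bound r B2"
      unfolding pole_bound_def
    proof (intro allI impI)
      fix l n m m' assume "B2 n m m' \<noteq> 0"
      then show "of_bool (n = ray l) \<le> crd r l + of_bool (crd m l \<noteq> 0) + of_bool (crd m' l \<noteq> 0)"
        using all[of l] ijk r by (cases "n = ray l") (auto simp: B2_def)
    qed
    moreover have "(\<Sum>x\<in>UNIV. B1 (ray x) (ediff k x) s) = 0" "(\<Sum>x\<in>UNIV. B2 (ray x) (ediff k x) s) = 0" for s
      using ijk by (simp_all add: sum_triple[OF ijk] B_defs)
    ultimately show "(if x then B1 else B2) \<in> V0 r" for x by (simp add: V0_eq[of r k])
    show "(if x then B1 else B2) (if y then ray i else ray j) (ediff k i)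
        (if y then ediff k i else ediff k j) = of_bool (x = y)" for x y
      using ijk by (simp add: B_defs)
    fix \<phi> assume "\<phi> \<in> V0 r"
    then have \<phi>: "trilinear \<phi>" "pole_bound r \<phi>"
      and tr: "(\<Sum>x\<in>UNIV. \<phi> (ray x) (ediff k x) (ediff k i)) = 0" by (simp_all add: V0_eq[of r k])
    have bound: "of_bool (n = ray i) + 1 \<le> (of_bool (crd m i \<noteq> 0) + of_bool (crd m' i \<noteq> 0) :: int)"
      "of_bool (n = ray j) \<le> (of_bool (crd m j \<noteq> 0) + of_bool (crd m' j \<noteq> 0) :: int)"
      if "\<phi> n m m' \<noteq> 0" for n m m'
      using \<phi>(2)[unfolded pole_bound_def, rule_format, OF that, of i]
        \<phi>(2)[unfolded pole_bound_def, rule_format, OF that, of j] r by simp_all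
    have bound': "crd m i \<noteq> 0 \<or> crd m' i \<noteq> 0" if "\<phi> n m m' \<noteq> 0" for n m m'
      using bound(1)[OF that] by (auto simp: of_bool_def split: if_splits)
    have "\<phi> (ray i) (ediff k i) (ediff k j) = 0" "\<phi> (ray i) (ediff k j) (ediff k i) = 0"
        "\<phi> (ray i) (ediff k j) (ediff k j) = 0" "\<phi> (ray j) (ediff k i) (ediff k i) = 0"
        "\<phi> (ray j) (ediff k j) (ediff k j) = 0"
      using bound(1)[of "ray i" "ediff k i" "ediff k j"] bound(1)[of "ray i" "ediff k j" "ediff k i"]
        bound(1)[of "ray i" "ediff k j" "ediff k j"] bound(2)[of "ray j" "ediff k i" "ediff k i"]
        bound'[of "ray j" "ediff k j" "ediff k j"] ijk
      by (auto simp: of_bool_def split: if_splits)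
    moreover have "\<phi> (ray j) (ediff k j) (ediff k i) = - \<phi> (ray i) (ediff k i) (ediff k i)"
      using tr by (simp add: sum_triple[OF ijk] trilinear_zero[OF \<phi>(1)] add_eq_0_iff)
    ultimately show "\<phi> = (\<Sum>x\<in>UNIV. scale_hom (\<phi> (if x then ray i else ray j) (ediff k i)
        (if x then ediff k i else ediff k j)) (if x then B1 else B2))"
      by (intro ext, subst trilinear_expand[OF \<phi>(1) ijk])
         (simp add: UNIV_bool B_defs scale_hom_def algebra_simps)
  qed simp
  then show ?thesis by simp
qed

text \<open>In the basis \<open>\<rho>\<^sub>1, \<rho>\<^sub>2\<close> let \<open>a, b, c\<close> be the coefficients of \<open>\<rho>\<^sub>1 \<otimes> \<rho>\<^sub>1\<close>, \<open>\<rho>\<^sub>1 \<otimes> \<rho>\<^sub>2\<close>, \<open>\<rho>\<^sub>2 \<otimes> \<rho>\<^sub>1\<close> in \<open>\<phi> \<rho>\<^sub>1\<close>.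
  The conditions at \<open>\<rho>\<^sub>1\<close> and \<open>\<rho>\<^sub>2\<close> remove \<open>\<rho>\<^sub>2 \<otimes> \<rho>\<^sub>2\<close> from \<open>\<phi> \<rho>\<^sub>1\<close> and \<open>\<rho>\<^sub>1 \<otimes> \<rho>\<^sub>1\<close> from \<open>\<phi> \<rho>\<^sub>2\<close>. Vanishing traces give the
  coefficients \<open>- a\<close> of \<open>\<rho>\<^sub>2 \<otimes> \<rho>\<^sub>1\<close> and \<open>- b\<close> of \<open>\<rho>\<^sub>2 \<otimes> \<rho>\<^sub>2\<close> in \<open>\<phi> \<rho>\<^sub>2\<close>. The condition at \<open>\<rho>\<^sub>0\<close>, evaluated at
  \<open>m = m' = e\<^sub>2 - e\<^sub>1\<close>, is one linear relation, which determines the last coefficient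
  \<open>2 a - 2 b - c\<close>. So \<open>a, b, c\<close> are free parameters.\<close>

lemma dim_V0_zero: "Hom_N.dim (V0 0) = 3"
proof -
  define B :: "complex \<Rightarrow> complex \<Rightarrow> complex \<Rightarrow> hom_N_NN" where
    "B a b c n m m' =
      pair (ediff 0 1) n * (a * of_int (crd m 1) * of_int (crd m' 1)
        + b * of_int (crd m 1) * of_int (crd m' 2) + c * of_int (crd m 2) * of_int (crd m' 1))
    + pair (ediff 0 2) n * (- b * of_int (crd m 2) * of_int (crd m' 2)
        + (2 * a - 2 * b - c) * of_int (crd m 1) * of_int (crd m' 2)
        - a * of_int (crd m 2) * of_int (crd m' 1))" for a b c n m m'
  have ijk: "1 \<noteq> (2::3)" "1 \<noteq> (0::3)" "2 \<noteq> (0::3)" by simp_all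
  have "Hom_N.dim (V0 0) = card (UNIV :: 3 set)"
  proof (rule dim_eq_card_evaluations[where B = "\<lambda>x. B (of_bool (x = 0)) (of_bool (x = 1)) (of_bool (x = 2))"
        and n = "\<lambda>x. ray 1" and m = "\<lambda>x. if x = 2 then ediff 0 2 else ediff 0 1"
        and m' = "\<lambda>x. if x = 1 then ediff 0 2 else ediff 0 1"])
    fix x :: 3
    have "trilinear (B a b c)" for a b c
      by (simp add: trilinear_def B_def pair_add pair_scale algebra_simps)
    moreover have "pole_bound 0 (B a b c)" for a b c
    proof -
      have "B a b c (ray l) m m' = 0" if "crd m l = 0" "crd m' l = 0" for l m m'
      proof -
        have "l = 0 \<or> l = 1 \<or> l = 2" using UNIV_3' by blast
        moreover have "crd m 0 = - crd m 1 - crd m 2" "crd m' 0 = - crd m' 1 - crd m' 2"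
          using sum_crd[of m] sum_crd[of m'] by (simp_all add: sum_3')
        ultimately show ?thesis
          using that by (auto simp: B_def algebra_simps)
      qed
      then show ?thesis
        unfolding pole_bound_def by (auto simp: of_bool_def split: if_splits)
    qed
    moreover have "(\<Sum>x\<in>UNIV. B a b c (ray x) (ediff 0 x) s) = 0" for a b c s
      by (simp add: sum_3' B_def algebra_simps)
    ultimately show "B (of_bool (x = 0)) (of_bool (x = 1)) (of_bool (x = 2)) \<in> V0 0"
      by (simp add: V0_eq[of 0 0])
    fix y :: 3
    show "B (of_bool (x = 0)) (of_bool (x = 1)) (of_bool (x = 2)) (ray 1)
        (if y = 2 then ediff 0 2 else ediff 0 1) (if y = 1 then ediff 0 2 else ediff 0 1) = of_bool (x = y)"
    proof -
      have "x = 0 \<or> x = 1 \<or> x = 2" "y = 0 \<or> y = 1 \<or> y = 2" using UNIV_3' by blast+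
      then show ?thesis by (auto simp: B_def)
    qed
  next
    fix \<phi> assume "\<phi> \<in> V0 0"
    then have \<phi>: "trilinear \<phi>" "pole_bound 0 \<phi>"
      and tr: "(\<Sum>x\<in>UNIV. \<phi> (ray x) (ediff 0 x) s) = 0" for s by (simp_all add: V0_eq[of 0 0])
    have zero: "\<phi> (ray l) m m' = 0" if "crd m l = 0" "crd m' l = 0" for l m m'
      using \<phi>(2)[unfolded pole_bound_def, rule_format, of "ray l" m m' l] that by auto
    have z: "\<phi> (ray 1) (ediff 0 2) (ediff 0 2) = 0" "\<phi> (ray 2) (ediff 0 1) (ediff 0 1) = 0"
      by (rule zero; simp)+
    have tr': "\<phi> (ray 2) (ediff 0 2) (ediff 0 1) = - \<phi> (ray 1) (ediff 0 1) (ediff 0 1)"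
        "\<phi> (ray 2) (ediff 0 2) (ediff 0 2) = - \<phi> (ray 1) (ediff 0 1) (ediff 0 2)"
      using tr[of "ediff 0 1"] tr[of "ediff 0 2"]
      by (simp_all add: sum_3' trilinear_zero[OF \<phi>(1)] add_eq_0_iff)
    \<comment> \<open>The relation at \<open>\<rho>\<^sub>0\<close>; \<open>ediff 1 2\<close> generates the kernel of the \<open>0\<close>-coordinate.\<close>
    have "\<phi> (ray 0) (ediff 1 2) (ediff 1 2) = 0"
      by (rule zero) simp_all
    then have rel: "\<phi> (ray 2) (ediff 0 1) (ediff 0 2) = 2 * \<phi> (ray 1) (ediff 0 1) (ediff 0 1)
        - 2 * \<phi> (ray 1) (ediff 0 1) (ediff 0 2) - \<phi> (ray 1) (ediff 0 2) (ediff 0 1)"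
      unfolding trilinear_expand[OF \<phi>(1) ijk, of "ray 0"] by (simp add: z tr' algebra_simps)
    show "\<phi> = (\<Sum>x\<in>(UNIV :: 3 set). scale_hom (\<phi> (ray 1) (if x = 2 then ediff 0 2 else ediff 0 1)
        (if x = 1 then ediff 0 2 else ediff 0 1)) (B (of_bool (x = 0)) (of_bool (x = 1)) (of_bool (x = 2))))"
      by (intro ext, subst trilinear_expand[OF \<phi>(1) ijk])
         (simp add: sum_3' B_def z tr' rel scale_hom_def algebra_simps)
  qed simp
  then show ?thesis by simp
qed

section \<open>The triangle of admissible degrees\<close>

lemma real_M_nth [simp]: "real_M r $ i = of_int (crd r i)"
  by (simp add: real_M_def)

lemma real_M_inject: "real_M r = real_M r' \<longleftrightarrow> r = r'"
  by (auto simp: vec_eq_iff intro: M_eqI)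

lemma crd_mpt:
  assumes "a + b + c = 0"
  shows "crd (mpt a b c) i = (if i = 0 then a else if i = 1 then b else c)"
  by (simp add: vec_of_mpt[OF assms])

lemma crd_r_vertex: "crd (r_vertex \<nu>) i = (if i = \<nu> then - 2 else 1)"
proof -
  have "\<nu> = 0 \<or> \<nu> = 1 \<or> \<nu> = 2" "i = 0 \<or> i = 1 \<or> i = 2" using UNIV_3' by blast+
  then show ?thesis by (auto simp: r_vertex_def vec_of_mpt)
qed

lemma crd_s_vertex: "crd (s_vertex \<nu>) \<nu> = 0"
proof -
  have "\<nu> = 0 \<or> \<nu> = 1 \<or> \<nu> = 2" using UNIV_3' by blast+
  then show ?thesis by (auto simp: s_vertex_def vec_of_mpt)
qed

definition vertices :: "(real ^ 3) set" where
  "vertices = (\<lambda>\<nu>. real_M (r_vertex \<nu>)) ` UNIV"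

lemma vertices_eq: "vertices = {real_M (mpt (-2) 1 1), real_M (mpt 1 (-2) 1), real_M (mpt 1 1 (-2))}"
  unfolding vertices_def UNIV_3' by (simp add: r_vertex_def)

lemma r_vertex_inj: "inj (\<lambda>\<nu>. real_M (r_vertex \<nu>))"
proof (rule injI)
  fix \<mu> \<nu> assume "real_M (r_vertex \<mu>) = real_M (r_vertex \<nu>)"
  then have "crd (r_vertex \<mu>) \<mu> = crd (r_vertex \<nu>) \<mu>" by (simp add: real_M_inject)
  then show "\<mu> = \<nu>" by (simp add: crd_r_vertex split: if_splits)
qed

text \<open>The coordinates of \<open>r\<^sup>\<nu>\<close> are \<open>1 - 3 [i = \<nu>]\<close>, so an affine combination of the vertices shows its own
  barycentric coordinates; the triangle is described by \<open>x\<^sub>i \<le> 1\<close> and its three sides by \<open>x\<^sub>i = 1\<close>.\<close>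

lemma combination_nth:
  assumes "(\<Sum>\<nu>\<in>UNIV. u \<nu>) = (c :: real)"
  shows "(\<Sum>\<nu>\<in>UNIV. u \<nu> *\<^sub>R real_M (r_vertex \<nu>)) $ i = c - 3 * u i"
proof -
  have "(\<Sum>\<nu>\<in>UNIV. u \<nu> *\<^sub>R real_M (r_vertex \<nu>)) $ i = (\<Sum>\<nu>\<in>UNIV. u \<nu> - (if \<nu> = i then 3 * u \<nu> else 0))"
    unfolding sum_component by (intro sum.cong refl) (simp add: crd_r_vertex)
  then show ?thesis using assms by (simp add: sum_subtractf)
qed

lemma sum_vertices: "(\<Sum>x\<in>vertices. f x) = (\<Sum>\<nu>\<in>UNIV. f (real_M (r_vertex \<nu>)))"
  unfolding vertices_def by (simp add: sum.reindex[OF r_vertex_inj])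

lemma vertices_affine_independent: "\<not> affine_dependent vertices"
proof
  assume "affine_dependent vertices"
  moreover have "finite vertices" by (simp add: vertices_def)
  ultimately obtain U where U: "sum U vertices = 0" "\<exists>v\<in>vertices. U v \<noteq> 0" "(\<Sum>v\<in>vertices. U v *\<^sub>R v) = 0"
    by (auto simp: affine_dependent_explicit_finite)
  note sums = U(1,3)[unfolded sum_vertices]
  have "U (real_M (r_vertex i)) = 0" for i
    using combination_nth[OF sums(1), of i] unfolding sums(2) by simp
  then show False using U(2) by (auto simp: vertices_def)
qed

lemma barycentric:
  assumes "(\<Sum>i\<in>UNIV. x $ i) = (0 :: real)"
  shows "(\<Sum>\<nu>\<in>UNIV. (1 - x $ \<nu>) / 3) = 1"
    and "(\<Sum>\<nu>\<in>UNIV. ((1 - x $ \<nu>) / 3) *\<^sub>R real_M (r_vertex \<nu>)) = x"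
proof -
  show 1: "(\<Sum>\<nu>\<in>UNIV. (1 - x $ \<nu>) / 3) = 1"
    using assms by (simp add: sum_3' field_simps)
  show "(\<Sum>\<nu>\<in>UNIV. ((1 - x $ \<nu>) / 3) *\<^sub>R real_M (r_vertex \<nu>)) = x"
    unfolding vec_eq_iff combination_nth[OF 1] by (simp add: field_simps)
qed

lemma sum_real_M: "(\<Sum>i\<in>UNIV. real_M r $ i) = 0"
  using sum_crd[of r] by (simp flip: of_int_sum)

text \<open>Barycentric coordinates indexed by \<open>\<nu>\<close>, turned into a function on the set of vertices.\<close>

definition vertex_coeff :: "(3 \<Rightarrow> real) \<Rightarrow> real ^ 3 \<Rightarrow> real" where
  "vertex_coeff u x = u (the_inv (\<lambda>\<nu>. real_M (r_vertex \<nu>)) x)"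

lemma vertex_coeff [simp]: "vertex_coeff u (real_M (r_vertex \<nu>)) = u \<nu>"
  by (simp add: vertex_coeff_def the_inv_f_f[OF r_vertex_inj])

lemma real_M_in_triangle: "real_M r \<in> convex hull vertices \<longleftrightarrow> (\<forall>i. crd r i \<le> 1)"
proof
  assume "real_M r \<in> convex hull vertices"
  then obtain u where u: "\<forall>x\<in>vertices. 0 \<le> u x" "sum u vertices = 1" "(\<Sum>x\<in>vertices. u x *\<^sub>R x) = real_M r"
    by (auto simp: convex_hull_finite vertices_def)
  note sums = u(2,3)[unfolded sum_vertices]
  have "real_M r $ i = 1 - 3 * u (real_M (r_vertex i))" for i
    using combination_nth[OF sums(1), of i] unfolding sums(2) .
  moreover have "0 \<le> u (real_M (r_vertex i))" for i
    using u(1) by (simp add: vertices_def)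
  ultimately have "real_M r $ i \<le> 1" for i
    by simp
  then show "\<forall>i. crd r i \<le> 1" by simp
next
  assume le: "\<forall>i. crd r i \<le> 1"
  have "(\<Sum>\<nu>\<in>UNIV. ((1 - real_M r $ \<nu>) / 3) *\<^sub>R real_M (r_vertex \<nu>)) \<in> convex hull vertices"
    by (rule convex_sum)
       (use barycentric(1)[OF sum_real_M] le in \<open>auto simp: vertices_def intro: hull_inc\<close>)
  then show "real_M r \<in> convex hull vertices"
    by (simp only: barycentric(2)[OF sum_real_M])
qed

lemma real_M_in_frontier:
  "real_M r \<in> rel_frontier (convex hull vertices) \<longleftrightarrow> (\<forall>i. crd r i \<le> 1) \<and> (\<exists>i. crd r i = 1)"
proof
  assume rf: "real_M r \<in> rel_frontier (convex hull vertices)"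
  then obtain u where u: "\<exists>x\<in>vertices. u x = 0" "sum u vertices = 1" "(\<Sum>x\<in>vertices. u x *\<^sub>R x) = real_M r"
      and u0: "\<forall>x\<in>vertices. 0 \<le> u x"
    unfolding rel_frontier_convex_hull_explicit[OF vertices_affine_independent] by blast
  have "real_M r \<in> convex hull vertices"
    using u(2,3) u0 by (auto simp: convex_hull_finite vertices_def)
  moreover note sums = u(2,3)[unfolded sum_vertices]
  have eq: "real_M r $ i = 1 - 3 * u (real_M (r_vertex i))" for i
    using combination_nth[OF sums(1), of i] unfolding sums(2) .
  obtain i where "u (real_M (r_vertex i)) = 0"
    using u(1) by (auto simp: vertices_def)
  with eq[of i] have "crd r i = 1" by simp
  ultimately show "(\<forall>i. crd r i \<le> 1) \<and> (\<exists>i. crd r i = 1)"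
    by (auto simp: real_M_in_triangle)
next
  assume "(\<forall>i. crd r i \<le> 1) \<and> (\<exists>i. crd r i = 1)"
  then obtain i where le: "\<forall>i. crd r i \<le> 1" and i: "crd r i = 1" by blast
  show "real_M r \<in> rel_frontier (convex hull vertices)"
    unfolding rel_frontier_convex_hull_explicit[OF vertices_affine_independent]
  proof (intro CollectI exI[of _ "vertex_coeff (\<lambda>\<nu>. (1 - real_M r $ \<nu>) / 3)"] conjI)
    show "\<forall>x\<in>vertices. 0 \<le> vertex_coeff (\<lambda>\<nu>. (1 - real_M r $ \<nu>) / 3) x"
      using le by (auto simp: vertices_def)
    show "\<exists>x\<in>vertices. vertex_coeff (\<lambda>\<nu>. (1 - real_M r $ \<nu>) / 3) x = 0"
      using i by (intro bexI[of _ "real_M (r_vertex i)"]) (auto simp: vertices_def)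
    show "sum (vertex_coeff (\<lambda>\<nu>. (1 - real_M r $ \<nu>) / 3)) vertices = 1"
      by (simp only: sum_vertices vertex_coeff barycentric(1)[OF sum_real_M])
    show "(\<Sum>x\<in>vertices. vertex_coeff (\<lambda>\<nu>. (1 - real_M r $ \<nu>) / 3) x *\<^sub>R x) = real_M r"
      by (simp only: sum_vertices vertex_coeff barycentric(2)[OF sum_real_M])
  qed
qed

text \<open>A one-dimensional space of associated maps contains a nonzero one.\<close>

lemma r_vertex_admissible: "admissible (r_vertex \<nu>)"
proof -
  obtain j k where jk: "\<nu> \<noteq> j" "\<nu> \<noteq> k" "j \<noteq> k" by (rule complete_triple)
  have "V0 (r_vertex \<nu>) \<noteq> {} \<and> \<not> V0 (r_vertex \<nu>) \<subseteq> {0}"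
  proof -
    have "Hom_N.dim (V0 (r_vertex \<nu>)) = 1"
      by (rule dim_V0_vertex[OF jk]) (use jk in \<open>auto simp: crd_r_vertex\<close>)
    moreover have "Hom_N.dim S = 0" if "S \<subseteq> {0}" for S
      using that by (intro Hom_N.dim_unique[of "{}"] Hom_N.independent_empty) auto
    ultimately show ?thesis by fastforce
  qed
  then obtain \<phi> where "\<phi> \<in> V0 (r_vertex \<nu>)" "\<phi> \<noteq> 0" by blast
  then show ?thesis
    unfolding admissible_iff by (auto simp: V0_def V_eq fun_eq_iff)
qed

lemma higgs_range_eq: "higgs_range = convex hull vertices"
proof
  show "higgs_range \<subseteq> convex hull vertices"
    unfolding higgs_range_def
  proof (rule hull_minimal)
    show "real_M ` {r. admissible r} \<subseteq> convex hull vertices"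
      using admissible_degree_le by (auto simp: admissible_iff real_M_in_triangle)
  qed (rule convex_convex_hull)
  show "convex hull vertices \<subseteq> higgs_range"
    unfolding higgs_range_def
    by (rule hull_mono) (auto simp: vertices_def r_vertex_admissible)
qed

lemma extreme_iff: "real_M r extreme_point_of higgs_range \<longleftrightarrow> (\<exists>\<nu>. r = r_vertex \<nu>)"
  unfolding higgs_range_eq extreme_point_of_convex_hull_affine_independent[OF vertices_affine_independent]
  by (auto simp: vertices_def real_M_inject)

lemma triangle_boundary_points:
  fixes x y z :: int
  assumes "x + y + z = 0"
  shows "(x \<le> 1 \<and> y \<le> 1 \<and> z \<le> 1) \<and> (x = 1 \<or> y = 1 \<or> z = 1)
      \<and> \<not> ((x = -2 \<and> y = 1 \<and> z = 1) \<or> (x = 1 \<and> y = -2 \<and> z = 1) \<or> (x = 1 \<and> y = 1 \<and> z = -2))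
    \<longleftrightarrow> (x, y, z) \<in> {(-1, 0, 1), (-1, 1, 0), (0, -1, 1), (0, 1, -1), (1, -1, 0), (1, 0, -1)}"
    (is "?L \<longleftrightarrow> ?R")
proof
  assume L: ?L
  have z: "z = - x - y" using assms by linarith
  have "x \<le> 1" "y \<le> 1" "z \<le> 1" using L by blast+
  then have "-2 \<le> x" "-2 \<le> y" using z by linarith+
  then have "x = -2 \<or> x = -1 \<or> x = 0 \<or> x = 1" "y = -2 \<or> y = -1 \<or> y = 0 \<or> y = 1"
    using \<open>x \<le> 1\<close> \<open>y \<le> 1\<close> by linarith+
  then show ?R
    using L unfolding z by (elim disjE) simp_all
next
  assume ?R
  then show ?L by (simp, elim disjE conjE) simp_all
qed

lemma edge_degrees:
  "{r. real_M r \<in> rel_frontier higgs_range \<and> \<not> real_M r extreme_point_of higgs_range}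
    = (\<lambda>(a, b, c). mpt a b c) `
        {(-1, 0, 1), (-1, 1, 0), (0, -1, 1), (0, 1, -1), (1, -1, 0), (1, 0, -1)}" (is "?L = ?R")
proof -
  have L: "r \<in> ?L \<longleftrightarrow> (crd r 0, crd r 1, crd r 2) \<in>
        {(-1, 0, 1), (-1, 1, 0), (0, -1, 1), (0, 1, -1), (1, -1, 0), (1, 0, -1)}" for r
  proof -
    have ex: "(\<exists>i::3. P i) \<longleftrightarrow> P 0 \<or> P 1 \<or> P 2" for P
      using forall_3'[of "\<lambda>i. \<not> P i"] by blast
    have vertex: "r = r_vertex \<nu> \<longleftrightarrow> (\<forall>i. crd r i = (if i = \<nu> then - 2 else 1))" for \<nu>
    proof
      assume "\<forall>i. crd r i = (if i = \<nu> then - 2 else 1)"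
      then show "r = r_vertex \<nu>" by (intro M_eqI) (simp add: crd_r_vertex)
    qed (simp add: crd_r_vertex)
    have sum: "crd r 0 + crd r 1 + crd r 2 = 0"
      using sum_crd[of r] by (simp add: sum_3')
    show ?thesis
      unfolding mem_Collect_eq extreme_iff vertex
      unfolding higgs_range_eq real_M_in_frontier ex forall_3'
      using triangle_boundary_points[OF sum] by simp
  qed
  have R: "r \<in> ?R \<longleftrightarrow> (crd r 0, crd r 1, crd r 2) \<in>
        {(-1, 0, 1), (-1, 1, 0), (0, -1, 1), (0, 1, -1), (1, -1, 0), (1, 0, -1)}" for r
  proof -
    have "r = mpt a b c \<longleftrightarrow> crd r 0 = a \<and> crd r 1 = b \<and> crd r 2 = c" if "a + b + c = 0" for a b c
    proof
      assume "crd r 0 = a \<and> crd r 1 = b \<and> crd r 2 = c"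
      then have "\<forall>i. crd r i = crd (mpt a b c) i"
        unfolding forall_3' by (simp add: crd_mpt[OF that])
      then show "r = mpt a b c" by (intro M_eqI) simp
    qed (simp add: crd_mpt[OF that])
    then show ?thesis by simp
  qed
  show ?thesis by (rule set_eqI) (simp only: L R)
qed

lemma card_edge_degrees:
  "card {r. real_M r \<in> rel_frontier higgs_range \<and> \<not> real_M r extreme_point_of higgs_range} = 6"
proof -
  define T :: "(int \<times> int \<times> int) set" where
    "T = {(-1, 0, 1), (-1, 1, 0), (0, -1, 1), (0, 1, -1), (1, -1, 0), (1, 0, -1)}"
  have "inj_on (\<lambda>(a, b, c). mpt a b c) T"
  proof (rule inj_on_inverseI[where g = "\<lambda>r. (crd r 0, crd r 1, crd r 2)"])
    fix x assume "x \<in> T"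
    then show "(\<lambda>r. (crd r 0, crd r 1, crd r 2)) ((\<lambda>(a, b, c). mpt a b c) x) = x"
      unfolding T_def by (auto simp: crd_mpt)
  qed
  then have "card ((\<lambda>(a, b, c). mpt a b c) ` T) = card T" by (rule card_image)
  then show ?thesis unfolding edge_degrees T_def by simp
qed

lemma dim_V0_frontier:
  assumes "real_M r \<in> rel_frontier higgs_range" "\<not> real_M r extreme_point_of higgs_range"
  shows "Hom_N.dim (V0 r) = 2"
proof -
  have "r \<in> {r. real_M r \<in> rel_frontier higgs_range \<and> \<not> real_M r extreme_point_of higgs_range}"
    using assms by simp
  then obtain x where x: "r = (\<lambda>(a, b, c). mpt a b c) x"
    "x \<in> {(-1, 0, 1), (-1, 1, 0), (0, -1, 1), (0, 1, -1), (1, -1, 0), (1, 0, -1)}"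
    unfolding edge_degrees by (rule imageE)
  obtain a b c where abc: "x = (a, b, c)" by (cases x)
  have cases: "a = -1 \<and> b = 0 \<and> c = 1 \<or> a = -1 \<and> b = 1 \<and> c = 0 \<or> a = 0 \<and> b = -1 \<and> c = 1
      \<or> a = 0 \<and> b = 1 \<and> c = -1 \<or> a = 1 \<and> b = -1 \<and> c = 0 \<or> a = 1 \<and> b = 0 \<and> c = -1"
    using x(2) by (simp add: abc)
  then have "a + b + c = 0" by auto
  then have crd_r: "crd r 0 = a" "crd r 1 = b" "crd r 2 = c"
    by (simp_all add: x(1) abc crd_mpt)
  show ?thesis
    using cases
  proof (elim disjE conjE)
    assume "a = -1" "b = 0" "c = 1"
    then show ?thesis by (intro dim_V0_edge[of 0 1 2]) (simp_all add: crd_r)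
  next
    assume "a = -1" "b = 1" "c = 0"
    then show ?thesis by (intro dim_V0_edge[of 0 2 1]) (simp_all add: crd_r)
  next
    assume "a = 0" "b = -1" "c = 1"
    then show ?thesis by (intro dim_V0_edge[of 1 0 2]) (simp_all add: crd_r)
  next
    assume "a = 0" "b = 1" "c = -1"
    then show ?thesis by (intro dim_V0_edge[of 2 0 1]) (simp_all add: crd_r)
  next
    assume "a = 1" "b = -1" "c = 0"
    then show ?thesis by (intro dim_V0_edge[of 1 2 0]) (simp_all add: crd_r)
  next
    assume "a = 1" "b = 0" "c = -1"
    then show ?thesis by (intro dim_V0_edge[of 2 1 0]) (simp_all add: crd_r)
  qed
qed

theorem theorem23:
  shows "higgs_range = convex hull
      {real_M (mpt (-2) 1 1), real_M (mpt 1 (-2) 1), real_M (mpt 1 1 (-2))}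
    \<and> (\<forall>\<nu>::3. \<forall>\<phi>\<in>V (r_vertex \<nu>). contract \<phi> (s_vertex \<nu>) = (\<lambda>n. 0))
    \<and> (\<forall>r. real_M r extreme_point_of higgs_range \<longrightarrow> Hom_N.dim (V0 r) = 1)
    \<and> card {r. real_M r \<in> rel_frontier higgs_range \<and> \<not> real_M r extreme_point_of higgs_range} = 6
    \<and> (\<forall>r. real_M r \<in> rel_frontier higgs_range \<and> \<not> real_M r extreme_point_of higgs_range
          \<longrightarrow> Hom_N.dim (V0 r) = 2)
    \<and> Hom_N.dim (V0 0) = 3"
proof (intro conjI allI ballI impI)
  show "higgs_range = convex hull
      {real_M (mpt (-2) 1 1), real_M (mpt 1 (-2) 1), real_M (mpt 1 1 (-2))}"
    unfolding higgs_range_eq vertices_eq by (rule refl)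
  show "contract \<phi> (s_vertex \<nu>) = (\<lambda>n. 0)" if "\<phi> \<in> V (r_vertex \<nu>)" for \<nu> \<phi>
    by (rule contract_zero[OF that, where i = \<nu>]) (simp_all add: crd_r_vertex crd_s_vertex)
  show "Hom_N.dim (V0 r) = 1" if extreme: "real_M r extreme_point_of higgs_range" for r
  proof -
    obtain \<nu> where \<nu>: "r = r_vertex \<nu>" using extreme_iff[THEN iffD1, OF extreme] by (rule exE)
    obtain j k where jk: "\<nu> \<noteq> j" "\<nu> \<noteq> k" "j \<noteq> k" by (rule complete_triple)
    show ?thesis
      unfolding \<nu> by (rule dim_V0_vertex[OF jk]) (use jk in \<open>auto simp: crd_r_vertex\<close>)
  qed
  show "card {r. real_M r \<in> rel_frontier higgs_range \<and> \<not> real_M r extreme_point_of higgs_range} = 6"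
    by (rule card_edge_degrees)
  show "Hom_N.dim (V0 r) = 2"
    if "real_M r \<in> rel_frontier higgs_range \<and> \<not> real_M r extreme_point_of higgs_range" for r
    by (rule dim_V0_frontier[OF conjunct1[OF that] conjunct2[OF that]])
  show "Hom_N.dim (V0 0) = 3" by (rule dim_V0_zero)
qed

end
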